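(* Let $p>3$ be prime, $a,b\in\mathbb{Q}_p$ with $ab\ne0$, and suppose $(a,b)\in\Delta_2$. Let ( * ) denote the condition: either [$|D|_p=1$ and $D_0u_{p-2}^2\equiv 0\pmod p$] or [$0\le |D|_p<1$ and $\sqrt{D}$ exists]. Let ( ** ) denote the condition: either [$|D|_p=1$ and $D_0u_{p-2}^2\not\equiv 0,\ 9a_0^2\pmod p$] or [$0<|D|_p<1$ and $\sqrt{D}$ does not exist]. Then the equation $x^3+ax=b$ is 1. solvable in $(\mathbb{Z}_p^* )^{[3]}$ iff $|b|_p=1$ and ( * ) holds; 2. solvable in $(\mathbb{Z}_p\setminus\mathbb{Z}_p^* )^{[3]}$ iff $|b|_p<1$ and ( * ) holds; 3. solvable in $(\mathbb{Q}_p\setminus\mathbb{Z}_p)^{[3]}$ iff $|b|_p>1$ and ( * ) holds; 4. solvable in $(\mathbb{Z}_p^* )^{[1]}$ iff $|b|_p=1$ and ( ** ) holds; 5. solvable in $(\mathbb{Z}_p\setminus\mathbb{Z}_p^* )^{[1]}$ iff $|b|_p<1$ and ( ** ) holds; 6. solvable in $(\mathbb{Q}_p\setminus\mathbb{Z}_p)^{[1]}$ iff $|b|_p>1$ and ( ** ) holds.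
   Context: $\mathbb{Z}_p=\{x\in\mathbb{Q}_p:|x|_p\le1\}$, $\mathbb{Z}_p^*=\{x:|x|_p=1\}$. Every nonzero $c\in\mathbb{Q}_p$ is written $c=c^*/|c|_p$ with $c^*\in\mathbb{Z}_p^*$, $c^*=c_0+c_1p+\cdots$, $c_0\in\{1,\dots,p-1\}$. For nonzero $c$, "$\sqrt{c}$ exists" means $c_0^{(p-1)/2}\equiv1\pmod p$ and $\log_p|c|_p$ is even; for $c=0$, $\sqrt{c}$ is regarded as existing. $D_0=-4a_0^3-27b_0^2$, integers $u_n$: $u_1=0,u_2=-a_0,u_3=b_0,u_{n+3}=b_0u_n-a_0u_{n+1}$. $D=-4(a^* )^3-27(b^* )^2\in\mathbb{Z}_p$ (the discriminant of the normalized equation $y^3+a^*y=b^*$; equals $-4a^3-27b^2$ when $|a|_p=|b|_p=1$). $\Delta_2=\{(a,b): |a|_p^3=|b|_p^2,\ D_0u_{p-2}^2\not\equiv 9a_0^2 \pmod p\}$. Roots are taken in $\mathbb{Q}_p$ counted with multiplicity; "solvable in $A^{[n]}$" ($n\in\{1,3\}$) means the equation has exactly $n$ roots in $\mathbb{Q}_p$ (with multiplicity), all lying in $A$. *)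

theory Defs
  imports "HOL-Computational_Algebra.Computational_Algebra" "HOL-Library.Cardinality" "HOL-Number_Theory.Cong"
begin

text \<open>The prime p is encoded as the cardinality of a finite type of class prime_card,
  so that the p-adic integers and numbers can be types (parametric in p).\<close>

class prime_card = finite +
  assumes prime_card: "prime (CARD('a))"

definition pc :: "'p itself \<Rightarrow> int" where
  "pc _ = int CARD('p)"

text \<open>The p-adic integers as the inverse limit of the rings Z/p^n Z: a compatible family
  of residues f n in [0, p^n).\<close>

typedef ('p::finite) padic_int =
  "{f :: nat \<Rightarrow> int. (\<forall>n. 0 \<le> f n \<and> f n < int CARD('p) ^ n) \<and>
                      (\<forall>m n. m \<le> n \<longrightarrow> f n mod int CARD('p) ^ m = f m)}"
  morphisms rep_zp abs_zp
  by (rule exI[of _ "\<lambda>_. 0"]) auto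

setup_lifting type_definition_padic_int

lemma zp_range:
  fixes f :: "'p::finite padic_int"
  shows "0 \<le> rep_zp f n" "rep_zp f n < int CARD('p) ^ n"
  using rep_zp[of f] by auto

lemma zp_mod_self [simp]:
  fixes f :: "'p::finite padic_int"
  shows "rep_zp f n mod int CARD('p) ^ n = rep_zp f n"
  using zp_range[of f n] by simp

lemma zp_compat:
  fixes f :: "'p::finite padic_int"
  shows "m \<le> n \<Longrightarrow> rep_zp f n mod int CARD('p) ^ m = rep_zp f m"
  using rep_zp[of f] by auto

lemma zp_eqI:
  fixes f g :: "'p::finite padic_int"
  shows "(\<And>n. rep_zp f n = rep_zp g n) \<Longrightarrow> f = g"
  by (metis rep_zp_inject ext)

lemma card_pos_int: "0 < int CARD('p::finite) ^ n"
  by simp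

lemma mod_pow_le:
  fixes q :: int
  assumes "m \<le> n"
  shows "x mod q ^ n mod q ^ m = x mod q ^ m"
proof -
  have "q ^ m dvd q ^ n" using assms by (simp add: le_imp_power_dvd)
  thus ?thesis by (simp add: mod_mod_cancel)
qed

lemma compat_op:
  fixes q :: int
  assumes "m \<le> n" "x mod q ^ m = x'" "y mod q ^ m = y'"
  shows "(x + y) mod q ^ n mod q ^ m = (x' + y') mod q ^ m"
    and "(x * y) mod q ^ n mod q ^ m = (x' * y') mod q ^ m"
    and "(x - y) mod q ^ n mod q ^ m = (x' - y') mod q ^ m"
    and "(- x) mod q ^ n mod q ^ m = (- x') mod q ^ m"
  using assms by (simp_all add: mod_pow_le mod_simps flip: assms(2,3))

lemma card_ge2: "2 \<le> CARD('p::prime_card)"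
  using prime_card[where 'a='p] prime_ge_2_nat by blast

instantiation padic_int :: (prime_card) comm_ring_1
begin

lift_definition zero_padic_int :: "'a padic_int" is "\<lambda>_. 0" by auto

lift_definition one_padic_int :: "'a padic_int" is "\<lambda>n. 1 mod int CARD('a) ^ n"
  by (auto simp: mod_pow_le)

lift_definition plus_padic_int :: "'a padic_int \<Rightarrow> 'a padic_int \<Rightarrow> 'a padic_int"
  is "\<lambda>f g n. (f n + g n) mod int CARD('a) ^ n"
  by (auto simp: compat_op)

lift_definition times_padic_int :: "'a padic_int \<Rightarrow> 'a padic_int \<Rightarrow> 'a padic_int"
  is "\<lambda>f g n. (f n * g n) mod int CARD('a) ^ n"
  by (auto simp: compat_op)

lift_definition minus_padic_int :: "'a padic_int \<Rightarrow> 'a padic_int \<Rightarrow> 'a padic_int"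
  is "\<lambda>f g n. (f n - g n) mod int CARD('a) ^ n"
  by (auto simp: compat_op)

lift_definition uminus_padic_int :: "'a padic_int \<Rightarrow> 'a padic_int"
  is "\<lambda>f n. (- f n) mod int CARD('a) ^ n"
  by (auto simp: compat_op)

instance
proof
  fix a b c :: "'a padic_int"
  show "a * b * c = a * (b * c)"
    by (rule zp_eqI) (simp add: times_padic_int.rep_eq mod_simps mult.assoc)
  show "a * b = b * a"
    by (rule zp_eqI) (simp add: times_padic_int.rep_eq mult.commute)
  show "1 * a = a"
    by (rule zp_eqI) (simp add: times_padic_int.rep_eq one_padic_int.rep_eq mod_simps)
  show "(a + b) * c = a * c + b * c"
    by (rule zp_eqI) (simp add: times_padic_int.rep_eq plus_padic_int.rep_eq mod_simps distrib_right)
  show "a + b + c = a + (b + c)"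
    by (rule zp_eqI) (simp add: plus_padic_int.rep_eq mod_simps add.assoc)
  show "a + b = b + a"
    by (rule zp_eqI) (simp add: plus_padic_int.rep_eq add.commute)
  show "0 + a = a"
    by (rule zp_eqI) (simp add: plus_padic_int.rep_eq zero_padic_int.rep_eq)
  show "- a + a = 0"
    by (rule zp_eqI) (simp add: plus_padic_int.rep_eq uminus_padic_int.rep_eq zero_padic_int.rep_eq mod_simps)
  show "a - b = a + - b"
    by (rule zp_eqI) (simp add: plus_padic_int.rep_eq uminus_padic_int.rep_eq minus_padic_int.rep_eq mod_simps)
  show "(0::'a padic_int) \<noteq> 1"
  proof
    assume "(0::'a padic_int) = 1"
    hence "rep_zp (0::'a padic_int) 1 = rep_zp (1::'a padic_int) 1" by simp
    thus False using card_ge2[where 'p='a] by (simp add: zero_padic_int.rep_eq one_padic_int.rep_eq)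
  qed
qed

end

lemma prime_card_int: "prime (int CARD('p::prime_card))"
  using prime_card[where 'a='p] by simp

lemma zp_val_exists:
  fixes f :: "'p::prime_card padic_int"
  assumes "f \<noteq> 0"
  shows "\<exists>k. \<forall>N>k. \<exists>u. rep_zp f N = int CARD('p) ^ k * u \<and> \<not> int CARD('p) dvd u"
proof -
  define P where "P = int CARD('p)"
  have P2: "P \<ge> 2" using card_ge2[where 'p='p] by (simp add: P_def)
  have ex: "\<exists>n. rep_zp f n \<noteq> 0"
    using assms zp_eqI[of f 0] by (auto simp: zero_padic_int.rep_eq)
  define a where "a = (LEAST n. rep_zp f n \<noteq> 0)"
  have fa: "rep_zp f a \<noteq> 0" using LeastI_ex[OF ex] by (simp add: a_def)
  have f0: "rep_zp f 0 = 0" using zp_range[of f 0] by simp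
  have a1: "a \<ge> 1" using fa f0 by (cases a) auto
  have fk: "rep_zp f (a - 1) = 0"
    using not_less_Least[of "a - 1" "\<lambda>n. rep_zp f n \<noteq> 0"] a1 by (simp add: a_def)
  show ?thesis
  proof (rule exI[of _ "a - 1"], intro allI impI)
    fix N assume N: "N > a - 1"
    hence Na: "a \<le> N" by simp
    have d1: "rep_zp f N mod P ^ (a - 1) = 0"
      using zp_compat[of "a - 1" N f] Na fk by (simp add: P_def)
    have d2: "rep_zp f N mod P ^ a \<noteq> 0"
      using zp_compat[of a N f] Na fa by (simp add: P_def)
    have "P ^ (a - 1) dvd rep_zp f N" using d1 by (simp add: mod_eq_0_iff_dvd)
    then obtain u where u: "rep_zp f N = P ^ (a - 1) * u" by (rule dvdE)
    have "\<not> P dvd u"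
    proof
      assume "P dvd u"
      then obtain w where "u = P * w" by auto
      have pa: "P ^ a = P ^ (a - 1) * P" using a1 by (metis One_nat_def Suc_pred less_eq_Suc_le power_Suc2)
      have "rep_zp f N = P ^ a * w" using u \<open>u = P * w\<close> pa by (simp add: mult.assoc)
      thus False using d2 by simp
    qed
    thus "\<exists>u. rep_zp f N = int CARD('p) ^ (a - 1) * u \<and> \<not> int CARD('p) dvd u"
      using u by (auto simp: P_def)
  qed
qed

instance padic_int :: (prime_card) idom
proof
  fix f g :: "'a padic_int"
  assume f: "f \<noteq> 0" and g: "g \<noteq> 0"
  define P where "P = int CARD('a)"
  have pr: "prime P" using prime_card_int[where 'p='a] by (simp add: P_def)
  obtain k where k: "\<forall>N>k. \<exists>u. rep_zp f N = P ^ k * u \<and> \<not> P dvd u"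
    using zp_val_exists[OF f] unfolding P_def by blast
  obtain l where l: "\<forall>N>l. \<exists>u. rep_zp g N = P ^ l * u \<and> \<not> P dvd u"
    using zp_val_exists[OF g] unfolding P_def by blast
  define N where "N = k + l + 1"
  obtain u where u: "rep_zp f N = P ^ k * u" "\<not> P dvd u" using k[rule_format, of N] unfolding N_def by auto
  obtain w where w: "rep_zp g N = P ^ l * w" "\<not> P dvd w" using l[rule_format, of N] unfolding N_def by auto
  have nd: "\<not> P dvd u * w" using u(2) w(2) pr by (simp add: prime_dvd_mult_iff)
  have prod: "rep_zp f N * rep_zp g N = P ^ (k + l) * (u * w)"
    using u w by (simp add: power_add algebra_simps)
  have "\<not> P ^ N dvd rep_zp f N * rep_zp g N"
  proof
    assume "P ^ N dvd rep_zp f N * rep_zp g N"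
    moreover have eqN: "P ^ N = P ^ (k + l) * P" unfolding N_def by simp
    ultimately have "P ^ (k + l) * P dvd P ^ (k + l) * (u * w)" using prod by (simp only:)
    moreover have "P \<noteq> 0" using pr by (metis not_prime_0)
    ultimately have "P dvd u * w" using dvd_mult_cancel_left[of "P ^ (k + l)" P "u * w"] by simp
    thus False using nd by simp
  qed
  hence "rep_zp (f * g) N \<noteq> 0"
    unfolding times_padic_int.rep_eq P_def by (simp add: mod_eq_0_iff_dvd)
  thus "f * g \<noteq> 0" by (metis zero_padic_int.rep_eq)
qed

type_synonym 'p padic = "'p padic_int fract"

definition zp_embed :: "'p::prime_card padic_int \<Rightarrow> 'p padic" where
  "zp_embed z = Fract z 1"

definition zp_is_unit :: "'p::prime_card padic_int \<Rightarrow> bool" where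
  "zp_is_unit z \<longleftrightarrow> rep_zp z 1 \<noteq> 0"

text \<open>p-adic valuation: nonzero x is uniquely p^k * u with u a unit of Z_p.\<close>
definition padic_val :: "'p::prime_card padic \<Rightarrow> int" where
  "padic_val x = (THE k. \<exists>u. zp_is_unit u \<and> x = of_nat CARD('p) powi k * zp_embed u)"

definition padic_abs :: "'p::prime_card padic \<Rightarrow> real" where
  "padic_abs x = (if x = 0 then 0 else real CARD('p) powi (- padic_val x))"

definition padic_Zp :: "'p::prime_card padic set" where
  "padic_Zp = {x. padic_abs x \<le> 1}"

definition padic_Zp_units :: "'p::prime_card padic set" where
  "padic_Zp_units = {x. padic_abs x = 1}"

text \<open>The unit part c^* = c |c|_p (so that c = c^*/|c|_p).\<close>
definition unit_part :: "'p::prime_card padic \<Rightarrow> 'p padic" where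
  "unit_part c = c * of_nat CARD('p) powi (- padic_val c)"

definition digit0 :: "'p::prime_card padic \<Rightarrow> int" where
  "digit0 x = rep_zp (THE z. x = zp_embed z) 1"

text \<open>"sqrt c exists" in the sense of the paper.  Note log_p |c|_p = - v(c), so its parity
  is that of padic_val c.\<close>
definition sqrt_exists :: "'p::prime_card padic \<Rightarrow> bool" where
  "sqrt_exists c \<longleftrightarrow> c = 0 \<or>
     ([digit0 (unit_part c) ^ ((CARD('p) - 1) div 2) = 1] (mod int CARD('p)) \<and> even (padic_val c))"

text \<open>The integer sequence u_n: u_1 = 0, u_2 = -a0, u_3 = b0, u_(n+3) = b0 u_n - a0 u_(n+1).
  We also set u_0 = 1, which is consistent with the recursion (u_3 = b0 u_0 - a0 u_1);
  only indices n >= 1 are ever used.\<close>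
fun useq :: "int \<Rightarrow> int \<Rightarrow> nat \<Rightarrow> int" where
  "useq a0 b0 0 = 1"
| "useq a0 b0 (Suc 0) = 0"
| "useq a0 b0 (Suc (Suc 0)) = - a0"
| "useq a0 b0 (Suc (Suc (Suc n))) = b0 * useq a0 b0 n - a0 * useq a0 b0 (Suc n)"

definition coef0 :: "'p::prime_card padic \<Rightarrow> int" where
  "coef0 c = digit0 (unit_part c)"

definition D0 :: "'p::prime_card padic \<Rightarrow> 'p padic \<Rightarrow> int" where
  "D0 a b = - 4 * coef0 a ^ 3 - 27 * coef0 b ^ 2"

definition Dstar :: "'p::prime_card padic \<Rightarrow> 'p padic \<Rightarrow> 'p padic" where
  "Dstar a b = - 4 * unit_part a ^ 3 - 27 * unit_part b ^ 2"

definition Du :: "'p::prime_card padic \<Rightarrow> 'p padic \<Rightarrow> int" where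
  "Du a b = D0 a b * useq (coef0 a) (coef0 b) (CARD('p) - 2) ^ 2"

definition Delta2 :: "('p::prime_card padic \<times> 'p padic) set" where
  "Delta2 = {(a, b). padic_abs a ^ 3 = padic_abs b ^ 2 \<and>
                     \<not> [Du a b = 9 * coef0 a ^ 2] (mod int CARD('p))}"

definition cond_star :: "'p::prime_card padic \<Rightarrow> 'p padic \<Rightarrow> bool" where
  "cond_star a b \<longleftrightarrow>
     (padic_abs (Dstar a b) = 1 \<and> [Du a b = 0] (mod int CARD('p))) \<or>
     (0 \<le> padic_abs (Dstar a b) \<and> padic_abs (Dstar a b) < 1 \<and> sqrt_exists (Dstar a b))"

definition cond_2star :: "'p::prime_card padic \<Rightarrow> 'p padic \<Rightarrow> bool" where
  "cond_2star a b \<longleftrightarrow>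
     (padic_abs (Dstar a b) = 1 \<and> \<not> [Du a b = 0] (mod int CARD('p)) \<and>
        \<not> [Du a b = 9 * coef0 a ^ 2] (mod int CARD('p))) \<or>
     (0 < padic_abs (Dstar a b) \<and> padic_abs (Dstar a b) < 1 \<and> \<not> sqrt_exists (Dstar a b))"

text \<open>The equation x^3 + a x = b is solvable in A^[n]: it has exactly n roots in Q_p counted
  with multiplicity, all of which lie in A.\<close>
definition solvable_in :: "'p::prime_card padic \<Rightarrow> 'p padic \<Rightarrow> 'p padic set \<Rightarrow> nat \<Rightarrow> bool" where
  "solvable_in a b A n \<longleftrightarrow>
     size (proots [:- b, a, 0, 1:]) = n \<and> set_mset (proots [:- b, a, 0, 1:]) \<subseteq> A"

end

theory Submission
  imports "Berlekamp_Zassenhaus.Berlekamp_Type_Based" "HOL-Number_Theory.Euler_Criterion" Defs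
begin

text \<open>Since |a|^3 = |b|^2, the substitution x = p^k y turns the equation into
  y^3 + \<alpha> y = \<beta> with units \<alpha>, \<beta>, and every root is p^k times a unit; so all roots lie in
  the same one of the three regions as b. Modulo p, the number u_(p-2) is the coefficient
  of X^2 in X^p reduced modulo f = X^3 + \<alpha> X - \<beta>. If f has no root modulo p, then X^p is a
  conjugate of X in the field F_p[X]/(f), and this forces D_0 u^2 = 9 a_0^2, which \<open>Delta2\<close>
  excludes. So f has a root modulo p, even a simple one, and Hensel's lemma gives a root r of
  the cubic. The remaining quadratic factor has discriminant D / f'(r)^2, so there are three
  roots if D is a square and one otherwise. If |D| = 1, then D is a square iff u vanishes
  modulo p, again by looking at X^p modulo f.\<close>

section \<open>Cubics over the prime field\<close>

text \<open>The discriminant alone cannot decide the case |D| = 1: over F_p it is a nonzero square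
  both when the cubic splits and when it is irreducible. The X^2 coefficient u of X^p = u X^2 + v X
  + w modulo f is the finer invariant that separates these patterns. If f is irreducible, h = X^p
  satisfies h^2 + h X + X^2 + a = 0, and eliminating v and w from the coefficients leaves two
  branches: one is the identity excluded by \<open>Delta2\<close>, the other exhibits a root in F_p.
  If f splits with distinct roots, u X^2 + (v - 1) X + w vanishes at three points, so u = 0. If r is
  the only root, u = 0 would make X^p affine, and fixing r while permuting the other two roots would
  force X^p = X on F_{p^2}. The hypothesis p > 3 makes 2 and 3 invertible, as completing the square
  and the treatment of double roots require.\<close>

instance prime_card \<subseteq> Finite_Field.prime_card
  by standard (rule prime_card)

text \<open>In degree at most 3 every proper factorization contains a linear factor, and a linear
  factor has a root.\<close>

lemma irreducible_poly_if_no_root: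
  fixes f :: "'a::field poly"
  assumes deg: "1 < degree f" "degree f \<le> 3" and nr: "\<And>x. poly f x \<noteq> 0"
  shows "irreducible f"
proof (rule irreducibleI)
  show "f \<noteq> 0" using deg by auto
  show "\<not> is_unit f" using deg by (auto simp: is_unit_iff_degree)
  fix g h assume fgh: "f = g * h"
  have nz: "g \<noteq> 0" "h \<noteq> 0" using deg fgh by auto
  have "degree f = degree g + degree h" using fgh nz by (simp add: degree_mult_eq)
  moreover have "degree q \<noteq> 1" if "q dvd f" for q
  proof
    assume "degree q = 1"
    then obtain c d where q: "q = [:c, d:]" "d \<noteq> 0" by (metis degree1_coeffs)
    have "poly q (- c / d) = 0" using q by simp
    then show False using nr that by (metis dvdE mult_zero_left poly_mult)
  qed
  moreover have "g dvd f" "h dvd f" using fgh by auto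
  ultimately have "degree g \<noteq> 1" "degree h \<noteq> 1" "degree g + degree h \<le> 3" using deg by auto
  then have "degree g = 0 \<or> degree h = 0" by arith
  then show "is_unit g \<or> is_unit h" using nz by (auto simp: is_unit_iff_degree)
qed

text \<open>The p-th power map is additive and, by Fermat's little theorem, fixes the
  coefficients.\<close>

lemma pcompose_X_power_card:
  fixes f :: "'p::prime_card mod_ring poly"
  shows "pcompose f ([:0, 1:] ^ CARD('p)) = f ^ CARD('p)"
proof (induction f)
  case 0
  show ?case by simp
next
  case (pCons c f)
  have "pCons c f = [:c:] + [:0, 1:] * f" by simp
  then have "pCons c f ^ CARD('p) = [:c:] ^ CARD('p) + ([:0, 1:] * f) ^ CARD('p)"
    by (metis add_power_poly_mod_ring)
  also have "[:c:] ^ CARD('p) = [:c:]"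
    by (simp add: poly_const_pow fermat_theorem_mod_ring)
  finally show ?case using pCons.IH by (simp only: pcompose_pCons power_mult_distrib)
qed

text \<open>Frobenius maps roots of f to roots of f: modulo f, f(h) = f(X^p) = f^p = 0. Keeping h as
  a polynomial avoids building the quotient ring F_p[X]/(f).\<close>

lemma dvd_pcompose_X_power_card:
  fixes f :: "'p::prime_card mod_ring poly"
  assumes h: "f dvd [:0, 1:] ^ CARD('p) - h"
  shows "f dvd pcompose f h"
proof -
  let ?X = "[:0, 1:] ^ CARD('p) :: 'p mod_ring poly"
  have aux: "?X - h dvd pcompose g ?X - pcompose g h" for g :: "'p mod_ring poly"
  proof (induction g)
    case 0
    show ?case by simp
  next
    case (pCons c g)
    have "pcompose (pCons c g) ?X - pcompose (pCons c g) h
       = ?X * (pcompose g ?X - pcompose g h) + (?X - h) * pcompose g h"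
      by (simp add: pcompose_pCons algebra_simps)
    then show ?case using pCons.IH by (metis dvd_add dvd_mult dvd_triv_left)
  qed
  have "f dvd pcompose f ?X"
    unfolding pcompose_X_power_card by (simp add: dvd_power)
  moreover have "f dvd pcompose f ?X - pcompose f h"
    using h aux dvd_trans by blast
  ultimately show ?thesis by (metis dvd_diff add_diff_cancel_left' diff_add_cancel)
qed

text \<open>X^p - X is the product of all X - x with x in F_p, so a prime element dividing it
  divides one of these linear factors.\<close>

lemma irreducible_dvd_X_power_card_minus_X:
  fixes f :: "'p::prime_card mod_ring poly"
  assumes irr: "irreducible f" and d: "f dvd [:0, 1:] ^ CARD('p) - [:0, 1:]"
  shows "degree f \<le> 1"
proof -
  have pr: "prime_elem f" using irr by (simp add: field_poly_irreducible_imp_prime)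
  have "f dvd (\<Prod>x\<in>UNIV. [:0, 1:] - [:x:])" using d poly_identity_mod_p[of "[:0, 1:] :: 'p mod_ring poly"] by simp
  moreover have "\<exists>x\<in>A. f dvd [:0, 1:] - [:x:]" if "finite A" "f dvd (\<Prod>x\<in>A. [:0, 1:] - [:x:])" for A
    using that
  proof (induction A rule: finite_induct)
    case empty
    then show ?case using irr by (simp add: irreducible_def)
  next
    case (insert x A)
    then have "f dvd ([:0, 1:] - [:x:]) * (\<Prod>x\<in>A. [:0, 1:] - [:x:])" by simp
    then show ?case using prime_elem_dvd_multD[OF pr] insert.IH by blast
  qed
  ultimately obtain x where "f dvd [:0, 1:] - [:x:]" using finite by blast
  then have "f dvd [:- x, 1:]" by simp
  then have "degree f \<le> degree [:- x, 1:]" by (intro dvd_imp_degree_le) auto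
  then show ?thesis by simp
qed

text \<open>Multiplying by X and replacing X^3 by B - A X is exactly the recurrence of
  \<open>useq\<close>. The index of the X^2 coefficient is the exponent minus 2, which explains the
  index p - 2. The base case is X^3 = B - A X and uses the value 1 at index 0.\<close>

lemma X_power_mod_cubic:
  fixes A B :: "'a::comm_ring_1"
  assumes "A = of_int a" "B = of_int b"
  shows "[:- B, A, 0, 1:] dvd [:0, 1:] ^ (n + 3) -
     [:B * of_int (useq a b n), of_int (useq a b (n + 2)), of_int (useq a b (n + 1)):]"
proof (induction n)
  case 0
  show ?case using assms by (simp add: numeral_eq_Suc)
next
  case (Suc n)
  let ?f = "[:- B, A, 0, 1:]"
  let ?u = "\<lambda>n. of_int (useq a b n) :: 'a"
  have "[:0, 1:] ^ (Suc n + 3) - [:B * ?u (Suc n), ?u (Suc n + 2), ?u (Suc n + 1):]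
    = [:0, 1:] * ([:0, 1:] ^ (n + 3) - [:B * ?u n, ?u (n + 2), ?u (n + 1):]) + ?f * [:?u (n + 1):]"
    using assms by (simp add: algebra_simps numeral_eq_Suc)
  then show ?case using Suc.IH by (metis dvd_add dvd_mult dvd_triv_left)
qed

text \<open>The hypotheses \<open>e1\<close>--\<open>e3\<close> are the coefficients of h^2 + h X + X^2 + a modulo
  X^3 + a X - b, where h = u X^2 + v X + w is a second root of the cubic.\<close>

lemma no_root_elimination:
  fixes a b u v w :: "'a::field"
  assumes two: "(2::'a) \<noteq> 0" and three: "(3::'a) \<noteq> 0" and a: "a \<noteq> 0" and b: "b \<noteq> 0"
    and nr: "\<And>y. y ^ 3 + a * y \<noteq> b"
    and e1: "- a * u\<^sup>2 + v\<^sup>2 + 2 * u * w + v + 1 = 0"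
    and e2: "u\<^sup>2 * b - 2 * u * v * a + 2 * v * w + w - a * u = 0"
    and e3: "2 * u * v * b + w\<^sup>2 + u * b + a = 0"
  shows "(- 4 * a ^ 3 - 27 * b\<^sup>2) * u\<^sup>2 = 9 * a\<^sup>2"
proof -
  \<comment> \<open>Completing the square in \<open>v\<close>. Together with \<open>t\<close> below,
    where \<open>t * s = u * b\<close>, it turns \<open>e2\<close> into a formula for
    \<open>w\<close> and makes \<open>e1\<close> and \<open>e3\<close> polynomial in
    \<open>s^2\<close>, \<open>t\<close> and \<open>u^2\<close>.\<close>
  define s where "s = 2 * v + 1"
  \<comment> \<open>With \<open>u = 0\<close> one gets s^2 = -3, which is nonzero; then
    \<open>w = 0\<close> and hence \<open>a = 0\<close>.\<close>
  have u: "u \<noteq> 0"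
  proof
    assume "u = 0"
    then have e: "v\<^sup>2 + v + 1 = 0" "s * w = 0" "w\<^sup>2 + a = 0" using e1 e2 e3 by (simp_all add: s_def algebra_simps)
    have "s\<^sup>2 + 3 = 4 * (v\<^sup>2 + v + 1)" by (simp add: s_def power2_eq_square algebra_simps)
    then have "s\<^sup>2 + 3 = 0" using e by simp
    then have "s \<noteq> 0" using three by auto
    then show False using e a by auto
  qed
  have e2': "w * s = u * (a * s - u * b)"
    using e2 unfolding s_def by Groebner_Basis.algebra \<comment> \<open>plain \<open>algebra\<close> is shadowed by the HOL-Algebra method\<close>
  have s: "s \<noteq> 0" using e2' u b by auto
  define t where "t = u * b / s"
  have ts: "t * s = u * b" using s by (simp add: t_def)
  have t: "t \<noteq> 0" using u b s by (simp add: t_def)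
  have "w * s = u * (a - t) * s" using e2' ts by Groebner_Basis.algebra
  then have w: "w = u * (a - t)" using s by simp
  have E1: "s\<^sup>2 + 3 + 4 * a * u\<^sup>2 - 8 * u\<^sup>2 * t = 0"
    using e1 unfolding s_def w by Groebner_Basis.algebra
  have E3: "s\<^sup>2 * t + u\<^sup>2 * (a - t)\<^sup>2 + a = 0"
    using e3 ts unfolding s_def w by Groebner_Basis.algebra
  \<comment> \<open>Subtracting \<open>t\<close> times \<open>E1\<close> from \<open>E3\<close>
    removes \<open>s^2\<close> and leaves u^2 (3 t - a)^2 - (3 t - a).\<close>
  have "(3 * t - a) * (u\<^sup>2 * (3 * t - a) - 1) = 0"
    using E1 E3 by Groebner_Basis.algebra
  then consider "3 * t = a" | "u\<^sup>2 * (3 * t - a) = 1" by auto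
  then show ?thesis
  proof cases
    case 1
    then have as: "a * s = 3 * u * b" using ts by (metis mult.assoc)
    have "3 * (s\<^sup>2 + 3 + 4 * a * u\<^sup>2 - 8 * u\<^sup>2 * t) = 3 * s\<^sup>2 + 9 + 4 * a * u\<^sup>2"
      unfolding 1[symmetric] by (simp add: algebra_simps)
    then have "3 * s\<^sup>2 + 9 + 4 * a * u\<^sup>2 = 0" using E1 by simp
    then have "3 * (a * s)\<^sup>2 + 9 * a\<^sup>2 + 4 * a ^ 3 * u\<^sup>2 = 0" by Groebner_Basis.algebra
    then show ?thesis unfolding as by Groebner_Basis.algebra
  next
    case 2 \<comment> \<open>here - b / t would be a root\<close>
    have "s\<^sup>2 * (3 * t - a) = - t - a" using E1 2 by Groebner_Basis.algebra
    moreover have "t\<^sup>2 * s\<^sup>2 = u\<^sup>2 * b\<^sup>2" using ts by Groebner_Basis.algebra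
    ultimately have "b\<^sup>2 + a * t\<^sup>2 + t ^ 3 = 0" using 2 by Groebner_Basis.algebra
    then have "(- b / t) ^ 3 + a * (- b / t) = b"
      using t by (simp add: field_simps) Groebner_Basis.algebra
    then show ?thesis using nr by blast
  qed
qed

text \<open>The cofactor of X - r is X^2 + r X + r^2 + A, with discriminant -3 r^2 - 4 A; hypothesis
  \<open>x\<close> is its equation after completing the square.\<close>

lemma cubic_root_if_quadratic_root:
  fixes A B r x :: "'a::field"
  assumes two: "(2::'a) \<noteq> 0" and r: "r ^ 3 + A * r = B" and x: "(2 * x + r)\<^sup>2 = - 3 * r\<^sup>2 - 4 * A"
  shows "x ^ 3 + A * x = B"
proof -
  have "2 * (2 * (x\<^sup>2 + r * x + r\<^sup>2 + A)) = 0" using x by Groebner_Basis.algebra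
  then have "x\<^sup>2 + r * x + r\<^sup>2 + A = 0" using two by (simp only: mult_eq_0_iff) simp
  then show ?thesis using r by Groebner_Basis.algebra
qed

lemma poly_dvd_imp_eq_0:
  fixes f g :: "'a::idom poly"
  assumes "f dvd g" "degree g < degree f"
  shows "g = 0"
  using dvd_imp_degree_le[OF assms(1)] assms(2) by linarith

lemma numeral_mod_ring_neq_0:
  assumes "CARD('p::prime_card) > 3"
  shows "(2 :: 'p mod_ring) \<noteq> 0" "(3 :: 'p mod_ring) \<noteq> 0"
proof -
  have "(of_nat k :: 'p mod_ring) \<noteq> 0" if "0 < k" "k \<le> 3" for k
    using of_nat_0_mod_ring_dvd[of k, where 'a='p] that assms by (auto dest!: dvd_imp_le)
  from this[of 2] this[of 3] show "(2 :: 'p mod_ring) \<noteq> 0" "(3 :: 'p mod_ring) \<noteq> 0" by simp_all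
qed

section \<open>Root patterns of the cubic over F_p, read off from X^p\<close>

context
  fixes a b :: int and A B u v w :: "'p::prime_card mod_ring"
  assumes card: "CARD('p) > 3"
  defines "A \<equiv> of_int a" and "B \<equiv> of_int b"
    and "u \<equiv> of_int (useq a b (CARD('p) - 2))"
    and "v \<equiv> of_int (useq a b (CARD('p) - 1))"
    and "w \<equiv> B * of_int (useq a b (CARD('p) - 3))"
  assumes A: "A \<noteq> 0" and B: "B \<noteq> 0"
begin

lemma X_power_card_mod_cubic: "[:- B, A, 0, 1:] dvd [:0, 1:] ^ CARD('p) - [:w, v, u:]"
proof -
  have "CARD('p) - 3 + 3 = CARD('p)" "CARD('p) - 3 + 2 = CARD('p) - 1" "CARD('p) - 3 + 1 = CARD('p) - 2"
    using card by auto
  then show ?thesis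
    using X_power_mod_cubic[of A a B b "CARD('p) - 3"] by (simp add: A_def B_def u_def v_def w_def)
qed

text \<open>Evaluating the congruence for X^p at r removes the multiple of the cubic, and r^p = r in
  F_p.\<close>

lemma root_fixed:
  assumes "r ^ 3 + A * r = B"
  shows "u * r\<^sup>2 + v * r + w = r"
proof -
  have "poly [:- B, A, 0, 1:] r = 0" using assms by (simp add: algebra_simps power3_eq_cube)
  then have "poly ([:0, 1:] ^ CARD('p) - [:w, v, u:]) r = 0"
    using X_power_card_mod_cubic by (metis dvdE mult_zero_left poly_mult)
  then show ?thesis
    by (simp add: fermat_theorem_mod_ring algebra_simps power2_eq_square)
qed

lemma no_root_imp_Du_eq:
  assumes nr: "\<And>y. y ^ 3 + A * y \<noteq> B"
  shows "(- 4 * A ^ 3 - 27 * B\<^sup>2) * u\<^sup>2 = 9 * A\<^sup>2"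
proof -
  let ?f = "[:- B, A, 0, 1:]" and ?h = "[:w, v, u:]" and ?X = "[:0, 1:] :: 'p mod_ring poly"
  have irr: "irreducible ?f"
  proof (rule irreducible_poly_if_no_root)
    fix x show "poly ?f x \<noteq> 0" using nr[of x] by (simp add: algebra_simps power3_eq_cube)
  qed auto
  have "?f dvd pcompose ?f ?h" by (rule dvd_pcompose_X_power_card[OF X_power_card_mod_cubic])
  \<comment> \<open>f(h) - f(X) is divisible by h - X; the cofactor is the condition on the
    conjugates of X other than X itself.\<close>
  moreover have "pcompose ?f ?h = (?h - ?X) * (?h * ?h + ?h * ?X + ?X * ?X + [:A:]) + ?f"
  proof -
    have "pcompose ?f ?h = ?h * ?h * ?h + [:A:] * ?h - [:B:]" by (simp add: pcompose_pCons algebra_simps)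
    moreover have "?f = ?X * ?X * ?X + [:A:] * ?X - [:B:]" by simp
    ultimately show ?thesis by (simp only:) (simp only: algebra_simps)
  qed
  ultimately have "?f dvd (?h - ?X) * (?h * ?h + ?h * ?X + ?X * ?X + [:A:]) + ?f" by (simp only:)
  from dvd_diff[OF this dvd_refl] have "?f dvd (?h - ?X) * (?h * ?h + ?h * ?X + ?X * ?X + [:A:])"
    unfolding add_diff_cancel_right' .
  then have "?f dvd ?h - ?X \<or> ?f dvd ?h * ?h + ?h * ?X + ?X * ?X + [:A:]"
    by (rule prime_elem_dvd_multD[OF field_poly_irreducible_imp_prime[OF irr]])
  \<comment> \<open>Otherwise X^p = X modulo an irreducible polynomial of degree 3.\<close>
  moreover have "\<not> ?f dvd ?h - ?X"
  proof
    assume "?f dvd ?h - ?X"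
    then have "?f dvd ?X ^ CARD('p) - ?h + (?h - ?X)" using X_power_card_mod_cubic dvd_add by blast
    then have "?f dvd ?X ^ CARD('p) - ?X" by (simp only: add_diff_eq diff_add_cancel)
    then have "degree ?f \<le> 1" by (rule irreducible_dvd_X_power_card_minus_X[OF irr])
    then show False by simp
  qed
  ultimately have "?f dvd ?h * ?h + ?h * ?X + ?X * ?X + [:A:]" by blast
  \<comment> \<open>\<open>R\<close> is the remainder of the quartic cofactor on division by f, the
    quotient being u^2 X + (2 u v + u). Its degree is below 3, so divisibility by f makes its three
    coefficients vanish.\<close>
  moreover define R where "R = [:2 * u * v * B + w\<^sup>2 + u * B + A,
     u\<^sup>2 * B - 2 * u * v * A + 2 * v * w + w - A * u, - A * u\<^sup>2 + v\<^sup>2 + 2 * u * w + v + 1:]"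
  moreover have "?h * ?h + ?h * ?X + ?X * ?X + [:A:] = ?f * [:2 * u * v + u, u\<^sup>2:] + R"
    by (simp add: R_def algebra_simps power2_eq_square one_pCons del: pCons_one)
  ultimately have "?f dvd ?f * [:2 * u * v + u, u\<^sup>2:] + R" by (simp only:)
  from dvd_diff[OF this dvd_triv_left[of _ "[:2 * u * v + u, u\<^sup>2:]"]]
  have "?f dvd R" unfolding add_diff_cancel_left' .
  then have "R = 0" by (rule poly_dvd_imp_eq_0) (simp add: R_def)
  then have "2 * u * v * B + w\<^sup>2 + u * B + A = 0"
    "u\<^sup>2 * B - 2 * u * v * A + 2 * v * w + w - A * u = 0" "- A * u\<^sup>2 + v\<^sup>2 + 2 * u * w + v + 1 = 0"
    by (simp_all add: R_def)
  then show ?thesis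
    by (intro no_root_elimination[OF numeral_mod_ring_neq_0[OF card] A B nr])
qed

text \<open>The square root \<open>d\<close> yields two further roots, and all three are fixed by
  Frobenius. A polynomial u X^2 + (v - 1) X + w with three distinct zeros is zero.\<close>

lemma three_roots_imp_u_eq_0:
  assumes r: "r ^ 3 + A * r = B" and D: "- 4 * A ^ 3 - 27 * B\<^sup>2 = d\<^sup>2" and d: "d \<noteq> 0"
  shows "u = 0"
proof -
  note n = numeral_mod_ring_neq_0[OF card]
  define g where "g = 3 * r\<^sup>2 + A"
  \<comment> \<open>For f = (X - r) q the discriminant is q(r)^2 times that of q, and q(r) = f'(r) =
    \<open>g\<close>.\<close>
  have fac: "- 4 * A ^ 3 - 27 * B\<^sup>2 = g\<^sup>2 * (- 3 * r\<^sup>2 - 4 * A)"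
    unfolding g_def r[symmetric] by Groebner_Basis.algebra
  have g: "g \<noteq> 0" using fac D d by auto
  define e where "e = d / g"
  have e: "e\<^sup>2 = - 3 * r\<^sup>2 - 4 * A" "e \<noteq> 0" using D d fac g by (auto simp: e_def power_divide)
  define x where "x = (- r + e) / 2"
  define y where "y = (- r - e) / 2"
  have xy: "2 * x = - r + e" "2 * y = - r - e" using n by (auto simp: x_def y_def)
  have "2 * (x - y) = 2 * e" using xy by Groebner_Basis.algebra
  then have "x \<noteq> y" using e n by auto
  have "(2 * x + r)\<^sup>2 = - 3 * r\<^sup>2 - 4 * A" "(2 * y + r)\<^sup>2 = - 3 * r\<^sup>2 - 4 * A"
    unfolding xy using e by (simp_all add: power2_eq_square)
  then have rts: "x ^ 3 + A * x = B" "y ^ 3 + A * y = B"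
    using cubic_root_if_quadratic_root[OF n(1) r] by blast+
  \<comment> \<open>The product (x - r) (y - r) is q(r) = \<open>g\<close>; since this is nonzero,
    neither new root equals r.\<close>
  have "4 * ((x - r) * (y - r)) = (2 * x - 2 * r) * (2 * y - 2 * r)" by (simp add: algebra_simps)
  also have "\<dots> = 9 * r\<^sup>2 - e\<^sup>2" unfolding xy by (simp add: algebra_simps power2_eq_square)
  also have "\<dots> = 4 * g" unfolding e g_def by (simp add: algebra_simps)
  finally have "4 * ((x - r) * (y - r)) = 4 * g" .
  then have "2 * (2 * ((x - r) * (y - r) - g)) = 0" by simp
  then have "(x - r) * (y - r) = g" using n(1) by (simp only: mult_eq_0_iff) simp
  then have "x \<noteq> r" "y \<noteq> r" using g by auto
  have "u * x\<^sup>2 + v * x + w = x" "u * y\<^sup>2 + v * y + w = y" "u * r\<^sup>2 + v * r + w = r"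
    using root_fixed rts r by auto
  moreover have "(x - z) * (u * (x + z) + v - 1) = (u * x\<^sup>2 + v * x + w - x) - (u * z\<^sup>2 + v * z + w - z)" for z
    by (simp add: algebra_simps power2_eq_square)
  ultimately have "(x - y) * (u * (x + y) + v - 1) = 0" "(x - r) * (u * (x + r) + v - 1) = 0"
    by simp_all
  then have "u * (x + y) + v - 1 = 0" "u * (x + r) + v - 1 = 0" using \<open>x \<noteq> y\<close> \<open>x \<noteq> r\<close> by auto
  then have "u * (y - r) = 0" by Groebner_Basis.algebra
  then show ?thesis using \<open>y \<noteq> r\<close> by simp
qed

text \<open>If \<open>u = 0\<close>, then X^p is the affine \<open>v X + w\<close>. It must fix r
  and send a root of the irreducible cofactor \<open>?g\<close> to a root of \<open>?g\<close>;
  together these leave only X^p = X modulo \<open>?g\<close>, impossible in degree 2.\<close>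

lemma one_root_imp_u_neq_0:
  assumes r: "r ^ 3 + A * r = B" and D: "\<And>d. - 4 * A ^ 3 - 27 * B\<^sup>2 \<noteq> d\<^sup>2"
  shows "u \<noteq> 0"
proof
  assume u: "u = 0"
  note n = numeral_mod_ring_neq_0[OF card]
  let ?g = "[:A + r\<^sup>2, r, 1:]" and ?h = "[:w, v:]" and ?X = "[:0, 1:] :: 'p mod_ring poly"
  have r0: "r \<noteq> 0" using r B by auto
  have nr: "y\<^sup>2 + r * y + A + r\<^sup>2 \<noteq> 0" for y
  proof
    assume "y\<^sup>2 + r * y + A + r\<^sup>2 = 0"
    then have "- 4 * A ^ 3 - 27 * B\<^sup>2 = ((3 * r\<^sup>2 + A) * (2 * y + r))\<^sup>2"
      unfolding r[symmetric] by Groebner_Basis.algebra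
    then show False using D by blast
  qed
  have irr: "irreducible ?g"
  proof (rule irreducible_poly_if_no_root)
    fix x show "poly ?g x \<noteq> 0" using nr[of x] by (simp add: algebra_simps power2_eq_square)
  qed auto
  have fg: "[:- B, A, 0, 1:] = ?g * [:- r, 1:]"
    unfolding r[symmetric] by (simp add: algebra_simps power2_eq_square power3_eq_cube)
  have "[:w, v, u:] = ?h" using u by simp
  then have gX: "?g dvd ?X ^ CARD('p) - ?h"
    using X_power_card_mod_cubic unfolding fg by (simp only: dvd_mult_left)
  have "?g dvd pcompose ?g ?h" by (rule dvd_pcompose_X_power_card[OF gX])
  moreover define R where "R = [:w\<^sup>2 + r * w + (A + r\<^sup>2) * (1 - v\<^sup>2), 2 * v * w + r * v - v\<^sup>2 * r:]"
  moreover have "pcompose ?g ?h = ?g * [:v\<^sup>2:] + R"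
    by (simp add: R_def pcompose_pCons algebra_simps power2_eq_square)
  ultimately have "?g dvd ?g * [:v\<^sup>2:] + R" by (simp only:)
  from dvd_diff[OF this dvd_triv_left[of _ "[:v\<^sup>2:]"]]
  have "?g dvd R" unfolding add_diff_cancel_left' .
  then have "R = 0" by (rule poly_dvd_imp_eq_0) (simp add: R_def)
  then have R: "w\<^sup>2 + r * w + (A + r\<^sup>2) * (1 - v\<^sup>2) = 0" "v * (2 * w + r - v * r) = 0"
    by (simp_all add: R_def algebra_simps power2_eq_square)
  \<comment> \<open>With \<open>v = 0\<close> the constant \<open>w\<close> would be a root of
    \<open>?g\<close> in F_p.\<close>
  have "v \<noteq> 0" using R(1) nr[of w] by (auto simp: algebra_simps)
  then have "2 * w + r - v * r = 0" using R(2) by simp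
  moreover have "v * r + w = r" using root_fixed[OF r] u by simp
  ultimately have "3 * (r * (1 - v)) = 0" by Groebner_Basis.algebra
  then have "v = 1" using n r0 by auto
  moreover have "w = 0" using \<open>v * r + w = r\<close> \<open>v = 1\<close> by simp
  ultimately have "?g dvd ?X ^ CARD('p) - ?X" using gX by (simp only:)
  then have "degree ?g \<le> 1" by (rule irreducible_dvd_X_power_card_minus_X[OF irr])
  then show False by simp
qed

end

section \<open>p-adic integers\<close>

abbreviation zp_p :: "'p::prime_card padic_int" where
  "zp_p \<equiv> of_nat CARD('p)"

lemma rep_zp_of_nat:
  "rep_zp (of_nat k :: 'p::prime_card padic_int) n = int k mod int CARD('p) ^ n"
proof (induction k)
  case (Suc k)
  have "rep_zp (of_nat (Suc k) :: 'p padic_int) n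
    = (1 mod int CARD('p) ^ n + int k mod int CARD('p) ^ n) mod int CARD('p) ^ n"
    by (simp add: plus_padic_int.rep_eq one_padic_int.rep_eq Suc.IH)
  then show ?case by (simp add: mod_add_eq)
qed (simp add: zero_padic_int.rep_eq)

lemma rep_zp_of_int:
  "rep_zp (of_int k :: 'p::prime_card padic_int) n = k mod int CARD('p) ^ n"
  by (cases k rule: int_cases2)
    (simp_all only: of_int_minus of_int_of_nat_eq rep_zp_of_nat uminus_padic_int.rep_eq mod_minus_eq)

text \<open>Translates residues into divisibility, the language of all later limit arguments. The
  quotient is a shift: its k-th residue is the (n + k)-th residue of \<open>z\<close> divided by
  p^n.\<close>

lemma rep_zp_eq_0_iff:
  fixes z :: "'p::prime_card padic_int"
  shows "rep_zp z n = 0 \<longleftrightarrow> zp_p ^ n dvd z"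
proof
  let ?P = "int CARD('p)"
  assume z: "rep_zp z n = 0"
  have dv: "?P ^ n dvd rep_zp z (n + k)" for k
    using zp_compat[of n "n + k" z] z by (simp add: mod_eq_0_iff_dvd)
  define f where "f = (\<lambda>k. rep_zp z (n + k) div ?P ^ n)"
  have f: "?P ^ n * f k = rep_zp z (n + k)" for k using dv by (simp add: f_def)
  have pos: "?P ^ m > 0" for m by simp
  have "0 \<le> f k \<and> f k < ?P ^ k" for k
  proof -
    have "?P ^ n * f k < ?P ^ n * ?P ^ k"
      unfolding f using zp_range(2)[of z "n + k"] by (simp add: power_add)
    moreover have "0 \<le> ?P ^ n * f k" unfolding f by (rule zp_range)
    ultimately show ?thesis using pos[of n] by (simp add: zero_le_mult_iff)
  qed
  moreover have "f k mod ?P ^ m = f m" if "m \<le> k" for m k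
  proof -
    have "?P ^ n * (f k mod ?P ^ m) = (?P ^ n * f k) mod (?P ^ n * ?P ^ m)"
      by (rule mult_mod_right)
    also have "\<dots> = ?P ^ n * f m"
      unfolding f using zp_compat[of "n + m" "n + k" z] that by (simp add: power_add)
    finally show ?thesis using pos[of n] by simp
  qed
  ultimately have mem: "f \<in> {f. (\<forall>n. 0 \<le> f n \<and> f n < ?P ^ n) \<and> (\<forall>m n. m \<le> n \<longrightarrow> f n mod ?P ^ m = f m)}"
    by blast
  define w :: "'p padic_int" where "w = abs_zp f"
  have w: "rep_zp w = f" unfolding w_def by (rule abs_zp_inverse[OF mem])
  have "z = zp_p ^ n * w"
  proof (rule zp_eqI)
    fix k
    have "rep_zp (zp_p ^ n * w) k = (?P ^ n * f k) mod ?P ^ k"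
      using rep_zp_of_nat[of "CARD('p) ^ n" k, where 'p='p]
      by (simp add: times_padic_int.rep_eq w mod_simps)
    then show "rep_zp z k = rep_zp (zp_p ^ n * w) k"
      using zp_compat[of k "n + k" z] by (simp add: f)
  qed
  then show "zp_p ^ n dvd z" by simp
next
  assume "zp_p ^ n dvd z"
  then obtain w where "z = of_nat (CARD('p) ^ n) * w" by auto
  then show "rep_zp z n = 0"
    by (simp only: times_padic_int.rep_eq rep_zp_of_nat) simp
qed

lemma rep_zp_eq_iff:
  fixes x y :: "'p::prime_card padic_int"
  shows "rep_zp x n = rep_zp y n \<longleftrightarrow> zp_p ^ n dvd x - y"
proof -
  have "zp_p ^ n dvd x - y \<longleftrightarrow> (rep_zp x n - rep_zp y n) mod int CARD('p) ^ n = 0"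
    unfolding rep_zp_eq_0_iff[symmetric] minus_padic_int.rep_eq ..
  also have "\<dots> \<longleftrightarrow> rep_zp x n mod int CARD('p) ^ n = rep_zp y n mod int CARD('p) ^ n"
    by (simp only: mod_eq_dvd_iff mod_eq_0_iff_dvd)
  finally show ?thesis by simp
qed

lemma zp_is_unit_iff:
  fixes z :: "'p::prime_card padic_int"
  shows "zp_is_unit z \<longleftrightarrow> \<not> zp_p dvd z"
  using rep_zp_eq_0_iff[of z 1] by (simp add: zp_is_unit_def)

lemma zp_eq_0I:
  fixes z :: "'p::prime_card padic_int"
  assumes "\<And>n. zp_p ^ n dvd z"
  shows "z = 0"
proof (rule zp_eqI)
  fix n show "rep_zp z n = rep_zp 0 n"
    using assms[of n] unfolding rep_zp_eq_0_iff[symmetric] zero_padic_int.rep_eq .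
qed

lemma zp_p_neq_0: "(zp_p :: 'p::prime_card padic_int) \<noteq> 0"
proof -
  have "rep_zp (zp_p :: 'p padic_int) 2 \<noteq> 0"
    using card_ge2[where 'p='p] unfolding rep_zp_of_nat by (simp add: power2_eq_square)
  then show ?thesis by (metis zero_padic_int.rep_eq)
qed

lemma zp_p_not_dvd_1: "\<not> (zp_p :: 'p::prime_card padic_int) dvd 1"
proof -
  have "rep_zp (1 :: 'p padic_int) 1 \<noteq> 0"
    using card_ge2[where 'p='p] by (simp add: one_padic_int.rep_eq)
  then show ?thesis using rep_zp_eq_0_iff[of "1 :: 'p padic_int" 1] by simp
qed

lemma zp_p_dvd_mult_iff:
  fixes x y :: "'p::prime_card padic_int"
  shows "zp_p dvd x * y \<longleftrightarrow> zp_p dvd x \<or> zp_p dvd y"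
proof
  assume "zp_p dvd x * y"
  then have "rep_zp (x * y) 1 = 0" using rep_zp_eq_0_iff[of "x * y" 1] by simp
  then have "int CARD('p) dvd rep_zp x 1 * rep_zp y 1"
    by (simp add: times_padic_int.rep_eq mod_eq_0_iff_dvd)
  then have "int CARD('p) dvd rep_zp x 1 \<or> int CARD('p) dvd rep_zp y 1"
    by (rule prime_dvd_multD[OF prime_card_int])
  then have "rep_zp x 1 = 0 \<or> rep_zp y 1 = 0"
    using zp_mod_self[of x 1] zp_mod_self[of y 1] by (auto simp: mod_eq_0_iff_dvd)
  then show "zp_p dvd x \<or> zp_p dvd y" by (simp add: rep_zp_eq_0_iff)
qed auto

lemma zp_p_dvd_power_iff:
  fixes x :: "'p::prime_card padic_int"
  assumes "n > 0"
  shows "zp_p dvd x ^ n \<longleftrightarrow> zp_p dvd x"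
proof
  show "zp_p dvd x ^ n \<Longrightarrow> zp_p dvd x"
    by (induction n) (auto simp: zp_p_not_dvd_1 zp_p_dvd_mult_iff)
  show "zp_p dvd x \<Longrightarrow> zp_p dvd x ^ n"
    using assms dvd_power[of n x] dvd_trans by blast
qed

text \<open>The limit is diagonal: its n-th residue is that of the n-th term, which later terms no
  longer change.\<close>

lemma zp_complete:
  fixes x :: "nat \<Rightarrow> 'p::prime_card padic_int"
  assumes step: "\<And>n. zp_p ^ n dvd x (Suc n) - x n"
  shows "\<exists>L. \<forall>n. zp_p ^ n dvd L - x n"
proof -
  let ?P = "int CARD('p)"
  have "zp_p ^ m dvd x (m + k) - x m" for m k
  proof (induction k)
    case (Suc k)
    have "zp_p ^ m dvd x (Suc (m + k)) - x (m + k)"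
      using step[of "m + k"] by (meson dvd_trans le_add1 le_imp_power_dvd)
    then have "zp_p ^ m dvd (x (Suc (m + k)) - x (m + k)) + (x (m + k) - x m)" using Suc.IH by (rule dvd_add)
    then show ?case by simp
  qed simp
  then have eq: "rep_zp (x n) m = rep_zp (x m) m" if "m \<le> n" for m n
    using that rep_zp_eq_iff le_Suc_ex by metis
  define f where "f = (\<lambda>n. rep_zp (x n) n)"
  have "f n mod ?P ^ m = f m" if "m \<le> n" for m n
    using zp_compat[OF that, of "x n"] eq[OF that] by (simp add: f_def)
  then have mem: "f \<in> {f. (\<forall>n. 0 \<le> f n \<and> f n < ?P ^ n) \<and> (\<forall>m n. m \<le> n \<longrightarrow> f n mod ?P ^ m = f m)}"
    using zp_range by (auto simp: f_def)
  define L :: "'p padic_int" where "L = abs_zp f"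
  have "rep_zp L = f" unfolding L_def by (rule abs_zp_inverse[OF mem])
  then have "rep_zp L n = rep_zp (x n) n" for n by (simp add: f_def)
  then show ?thesis unfolding rep_zp_eq_iff by blast
qed

text \<open>Such a \<open>z\<close> has an integer inverse modulo every p^n, and these approximate
  inverses converge.\<close>

lemma zp_is_unit_imp_dvd_1:
  fixes z :: "'p::prime_card padic_int"
  assumes "\<not> zp_p dvd z"
  shows "z dvd 1"
proof -
  let ?P = "int CARD('p)"
  have "\<exists>y. zp_p ^ n dvd z * of_int y - 1" for n
  proof -
    have "algebraic_semidom_class.coprime (rep_zp z n) (?P ^ n)"
    proof (cases "n = 0")
      case False
      have "\<not> ?P dvd rep_zp z n"
      proof
        assume "?P dvd rep_zp z n"
        then have "rep_zp z 1 = 0" using zp_compat[of 1 n z] False by simp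
        then show False using assms rep_zp_eq_0_iff[of z 1] by simp
      qed
      then have "algebraic_semidom_class.coprime ?P (rep_zp z n)"
        by (rule prime_imp_coprime[OF prime_card_int])
      then show ?thesis by (simp add: ac_simps)
    qed simp
    then obtain y where y: "[rep_zp z n * y = 1] (mod ?P ^ n)" using cong_solve_coprime_int by blast
    have "rep_zp (z * of_int y) n = rep_zp (1 :: 'p padic_int) n"
      using y by (simp add: times_padic_int.rep_eq rep_zp_of_int one_padic_int.rep_eq cong_def mod_simps)
    then show ?thesis by (auto simp: rep_zp_eq_iff)
  qed
  then have "\<exists>y. \<forall>n. zp_p ^ n dvd z * of_int (y n) - 1" by (intro choice allI)
  then obtain y where y: "\<And>n. zp_p ^ n dvd z * of_int (y n) - 1" by blast
  have "zp_p ^ n dvd of_int (y (Suc n)) - (of_int (y n) :: 'p padic_int)" for n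
  proof -
    let ?a = "of_int (y n) :: 'p padic_int" and ?b = "of_int (y (Suc n)) :: 'p padic_int"
    have "zp_p ^ n dvd z * ?b - 1" using y[of "Suc n"] by (auto dest: dvd_mult_right)
    \<comment> \<open>The combination equals \<open>?b - ?a\<close>: two inverses modulo p^n agree
      modulo p^n.\<close>
    then have "zp_p ^ n dvd ?a * (z * ?b - 1) - ?b * (z * ?a - 1)"
      using y[of n] by (intro dvd_diff[OF dvd_mult dvd_mult])
    then show ?thesis by (simp add: algebra_simps)
  qed
  then have "\<exists>L::'p padic_int. \<forall>n. zp_p ^ n dvd L - of_int (y n)" by (rule zp_complete)
  then obtain L :: "'p padic_int" where L: "\<And>n. zp_p ^ n dvd L - of_int (y n)" by blast
  have "zp_p ^ n dvd z * L - 1" for n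
  proof -
    have "zp_p ^ n dvd z * (L - of_int (y n)) + (z * of_int (y n) - 1)"
      by (rule dvd_add[OF dvd_mult[OF L] y])
    then show ?thesis by (simp add: algebra_simps)
  qed
  then have "z * L - 1 = 0" by (rule zp_eq_0I)
  then show ?thesis by (metis dvd_triv_left eq_iff_diff_eq_0)
qed

section \<open>Taylor expansion and Hensel's lemma over Z_p\<close>

lemma poly_Taylor2:
  fixes F :: "'a::idom poly"
  shows "\<exists>q. poly F (x + h) = poly F x + h * poly (pderiv F) x + h * h * q"
proof (induction F)
  case 0
  show ?case by (rule exI[of _ 0]) simp
next
  case (pCons c G)
  then obtain q where q: "poly G (x + h) = poly G x + h * poly (pderiv G) x + h * h * q" by blast
  show ?case
    by (rule exI[of _ "poly (pderiv G) x + (x + h) * q"]) (unfold poly_pCons pderiv_pCons poly_add q, simp add: algebra_simps)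
qed

lemma poly_diff_dvd:
  fixes F :: "'a::idom poly"
  shows "x - y dvd poly F x - poly F y"
proof -
  obtain q where "poly F (y + (x - y)) = poly F y + (x - y) * poly (pderiv F) y + (x - y) * (x - y) * q"
    using poly_Taylor2 by blast
  then have "poly F x - poly F y = (x - y) * (poly (pderiv F) y + (x - y) * q)"
    by (simp add: algebra_simps)
  then show ?thesis by simp
qed

text \<open>Newton iteration, with one further power of p guaranteed at each step. The derivative
  remains a unit because its residue modulo p never changes.\<close>

lemma hensel:
  fixes F :: "'p::prime_card padic_int poly"
  assumes "zp_p dvd poly F x0" "\<not> zp_p dvd poly (pderiv F) x0"
  obtains r where "poly F r = 0" "zp_p dvd r - x0"
proof -
  \<comment> \<open>The exponent \<open>Suc n\<close> makes the hypothesis stage 0, and the square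
    of an increment divisible by p^(n+1) is then divisible by p^(n+2), as the next stage
    needs.\<close>
  let ?Q = "\<lambda>n x. zp_p ^ Suc n dvd poly F x \<and> zp_p dvd x - x0"
  have unit: "\<not> zp_p dvd poly (pderiv F) x" if "zp_p dvd x - x0" for x
  proof
    assume "zp_p dvd poly (pderiv F) x"
    moreover have "zp_p dvd poly (pderiv F) x - poly (pderiv F) x0"
      using that poly_diff_dvd dvd_trans by blast
    ultimately have "zp_p dvd poly (pderiv F) x - (poly (pderiv F) x - poly (pderiv F) x0)" by (rule dvd_diff)
    then show False using assms(2) by simp
  qed
  have step: "\<exists>y. ?Q (Suc n) y \<and> zp_p ^ n dvd y - x" if x: "?Q n x" for n x
  proof -
    obtain c where c: "poly F x = zp_p ^ Suc n * c" using x by blast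
    have "poly (pderiv F) x dvd 1" using zp_is_unit_imp_dvd_1[OF unit] x by blast
    then obtain i where i: "poly (pderiv F) x * i = 1" by (auto elim: dvdE)
    \<comment> \<open>The Newton increment -F(x) / F'(x), with \<open>i\<close> the inverse of
      F'(x).\<close>
    define h where "h = - (zp_p ^ Suc n * (c * i))"
    obtain q where "poly F (x + h) = poly F x + h * poly (pderiv F) x + h * h * q"
      using poly_Taylor2 by blast
    also have "h * poly (pderiv F) x = - poly F x * (poly (pderiv F) x * i)"
      unfolding h_def c by (simp add: algebra_simps)
    also have "\<dots> = - poly F x" by (simp add: i)
    finally have "poly F (x + h) = zp_p ^ Suc (Suc n) * (zp_p ^ n * (c * i * (c * i) * q))"
      by (simp add: h_def algebra_simps)
    then have "zp_p ^ Suc (Suc n) dvd poly F (x + h)" by simp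
    moreover have "zp_p dvd (x - x0) + h" using x by (intro dvd_add) (simp_all add: h_def)
    then have "zp_p dvd (x + h) - x0" by (simp add: algebra_simps)
    moreover have "zp_p ^ n dvd (x + h) - x" by (simp add: h_def mult.assoc)
    ultimately show ?thesis by blast
  qed
  have "\<exists>x. ?Q 0 x" using assms(1) by (intro exI[of _ x0]) simp
  from dependent_nat_choice[of ?Q "\<lambda>n x y. zp_p ^ n dvd y - x", OF this step]
  obtain x where x: "\<forall>n. ?Q n (x n) \<and> zp_p ^ n dvd x (Suc n) - x n" by (rule exE)
  have "\<exists>L. \<forall>n. zp_p ^ n dvd L - x n" using x by (intro zp_complete) simp
  then obtain L where L: "\<And>n. zp_p ^ n dvd L - x n" by blast
  have "zp_p ^ n dvd poly F L" for n
  proof -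
    have "zp_p ^ n dvd poly F L - poly F (x n)" using L poly_diff_dvd dvd_trans by blast
    moreover have "zp_p ^ n dvd poly F (x n)" using x[THEN spec, of n] by (auto dest: dvd_mult_right)
    ultimately have "zp_p ^ n dvd (poly F L - poly F (x n)) + poly F (x n)" by (rule dvd_add)
    then show ?thesis by simp
  qed
  then have "poly F L = 0" by (rule zp_eq_0I)
  moreover have "zp_p dvd (L - x 1) + (x 1 - x0)" using L[of 1] x[THEN spec, of 1] by (intro dvd_add) auto
  then have "zp_p dvd L - x0" by simp
  ultimately show ?thesis by (rule that)
qed

lemma zp_decompose:
  fixes z :: "'p::prime_card padic_int"
  assumes "z \<noteq> 0"
  obtains k u where "z = zp_p ^ k * u" "\<not> zp_p dvd u"
proof -
  have ex: "\<exists>n. \<not> zp_p ^ n dvd z" using assms zp_eq_0I by blast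
  define n where "n = (LEAST n. \<not> zp_p ^ n dvd z)"
  have n: "\<not> zp_p ^ n dvd z" using LeastI_ex[OF ex] by (simp add: n_def)
  then obtain k where k: "n = Suc k" by (cases n) auto
  then have "zp_p ^ k dvd z" using not_less_Least[of k "\<lambda>n. \<not> zp_p ^ n dvd z"] by (simp add: n_def)
  then obtain u where u: "z = zp_p ^ k * u" by blast
  moreover have "\<not> zp_p dvd u" using n unfolding u k by (auto simp: mult.assoc mult.left_commute)
  ultimately show ?thesis by (rule that)
qed

section \<open>p-adic numbers and squares\<close>

text \<open>Reduction modulo p, with values in the field type for which the results on cubics over
  F_p are stated.\<close>

definition zp_residue :: "'p::prime_card padic_int \<Rightarrow> 'p mod_ring" where
  "zp_residue z = of_int (rep_zp z 1)"

lemma of_int_mod_ring_eq_iff: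
  "(of_int x :: 'p::prime_card mod_ring) = of_int y \<longleftrightarrow> [x = y] (mod int CARD('p))"
  by (simp add: of_int_eq_iff_cong_CHAR)

lemma of_int_mod_card [simp]:
  "(of_int (x mod int CARD('p)) :: 'p::prime_card mod_ring) = of_int x"
  by (simp add: of_int_mod_ring_eq_iff cong_def)

lemma zp_residue_of_int [simp]: "zp_residue (of_int k :: 'p::prime_card padic_int) = of_int k"
  by (simp add: zp_residue_def rep_zp_of_int)

lemma zp_residue_numeral [simp]: "zp_residue (numeral k :: 'p::prime_card padic_int) = numeral k"
  using zp_residue_of_int[of "numeral k", where 'p='p] by simp

lemma zp_residue_add [simp]: "zp_residue (x + y) = zp_residue x + zp_residue y"
  by (simp add: zp_residue_def plus_padic_int.rep_eq flip: of_int_add)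

lemma zp_residue_diff [simp]: "zp_residue (x - y) = zp_residue x - zp_residue y"
  by (simp add: zp_residue_def minus_padic_int.rep_eq flip: of_int_diff)

lemma zp_residue_uminus [simp]: "zp_residue (- x) = - zp_residue x"
  by (simp add: zp_residue_def uminus_padic_int.rep_eq flip: of_int_minus)

lemma zp_residue_mult [simp]: "zp_residue (x * y) = zp_residue x * zp_residue y"
  by (simp add: zp_residue_def times_padic_int.rep_eq flip: of_int_mult)

lemma zp_residue_power [simp]: "zp_residue (x ^ n) = zp_residue x ^ n"
  by (induction n) (use zp_residue_of_int[of 1] in \<open>simp_all\<close>)

lemma zp_residue_eq_0_iff: "zp_residue (z :: 'p::prime_card padic_int) = 0 \<longleftrightarrow> zp_p dvd z"
proof -
  have "zp_residue z = 0 \<longleftrightarrow> (of_int (rep_zp z 1) :: 'p mod_ring) = of_int 0"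
    by (simp add: zp_residue_def)
  also have "\<dots> \<longleftrightarrow> rep_zp z 1 = 0"
    unfolding of_int_mod_ring_eq_iff using zp_mod_self[of z 1] by (simp add: cong_def)
  also have "\<dots> \<longleftrightarrow> zp_p dvd z" using rep_zp_eq_0_iff[of z 1] by simp
  finally show ?thesis .
qed

lemma mod_ring_of_int_cases: obtains k where "(x :: 'p::prime_card mod_ring) = of_int k"
  using surj_of_nat_mod_ring[of x] by (metis of_int_of_nat_eq)

lemma zp_embed_eq_to_fract: "zp_embed = to_fract"
  by (simp add: fun_eq_iff zp_embed_def to_fract_def)

lemma zp_embed_0 [simp]: "zp_embed 0 = 0" by (simp add: zp_embed_eq_to_fract)
lemma zp_embed_1 [simp]: "zp_embed 1 = 1" by (simp add: zp_embed_eq_to_fract)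
lemma zp_embed_add [simp]: "zp_embed (x + y) = zp_embed x + zp_embed y" by (simp add: zp_embed_eq_to_fract)
lemma zp_embed_diff [simp]: "zp_embed (x - y) = zp_embed x - zp_embed y" by (simp add: zp_embed_eq_to_fract)
lemma zp_embed_uminus [simp]: "zp_embed (- x) = - zp_embed x" by (simp add: zp_embed_eq_to_fract)
lemma zp_embed_mult [simp]: "zp_embed (x * y) = zp_embed x * zp_embed y" by (simp add: zp_embed_eq_to_fract)
lemma zp_embed_eq_iff [simp]: "zp_embed x = zp_embed y \<longleftrightarrow> x = y" by (simp add: zp_embed_eq_to_fract)
lemma zp_embed_power [simp]: "zp_embed (x ^ n) = zp_embed x ^ n" by (induction n) simp_all
lemma zp_embed_of_nat [simp]: "zp_embed (of_nat n) = of_nat n" by (induction n) simp_all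
lemma zp_embed_numeral [simp]: "zp_embed (numeral n) = numeral n"
  using zp_embed_of_nat[of "numeral n"] by simp
lemma zp_embed_eq_0_iff [simp]: "zp_embed x = 0 \<longleftrightarrow> x = 0"
  using zp_embed_eq_iff[of x 0] by simp

abbreviation qp_p :: "'p::prime_card padic" where
  "qp_p \<equiv> of_nat CARD('p)"

lemma qp_p_neq_0: "(qp_p :: 'p::prime_card padic) \<noteq> 0"
  using zp_embed_eq_0_iff[of "zp_p :: 'p padic_int"] zp_p_neq_0[where 'p='p] by simp

text \<open>Split numerator and denominator into powers of p and units; the unit of the denominator
  is invertible in Z_p.\<close>

lemma padic_decompose:
  fixes x :: "'p::prime_card padic"
  assumes "x \<noteq> 0"
  obtains k u where "x = qp_p powi k * zp_embed u" "\<not> zp_p dvd u"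
proof -
  obtain a b where ab: "x = Fract a b" "b \<noteq> 0" by (cases x) auto
  then have a: "a \<noteq> 0" using assms by (auto simp: Zero_fract_def eq_fract)
  have x: "x * zp_embed b = zp_embed a" using ab by (simp add: zp_embed_def eq_fract)
  obtain i s where s: "a = zp_p ^ i * s" "\<not> zp_p dvd s" using zp_decompose[OF a] .
  obtain j t where t: "b = zp_p ^ j * t" "\<not> zp_p dvd t" using zp_decompose[OF ab(2)] .
  obtain t' where t': "1 = t * t'" using zp_is_unit_imp_dvd_1[OF t(2)] by (rule dvdE)
  have et: "zp_embed t * zp_embed t' = 1" using t' by (metis zp_embed_1 zp_embed_mult)
  have "\<not> zp_p dvd t'"
    using t' zp_p_not_dvd_1[where 'p='p] by (metis dvd_mult)
  then have "\<not> zp_p dvd s * t'" using s by (simp add: zp_p_dvd_mult_iff)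
  moreover have "x = qp_p powi (int i - int j) * zp_embed (s * t')"
  proof -
    have "x * qp_p ^ j * (zp_embed t * zp_embed t') = qp_p ^ i * zp_embed s * zp_embed t'"
      using x unfolding s(1) t(1) by (simp add: mult.assoc[symmetric])
    then have "x = qp_p ^ i * zp_embed s * zp_embed t' / qp_p ^ j"
      using qp_p_neq_0[where 'p='p] unfolding et mult_1_right by (simp add: field_simps)
    then show ?thesis using qp_p_neq_0[where 'p='p] by (simp add: power_int_diff)
  qed
  ultimately show ?thesis using that by blast
qed

lemma padic_repr_less_False:
  fixes u v :: "'p::prime_card padic_int"
  assumes eq: "qp_p powi k * zp_embed u = qp_p powi l * zp_embed v" and u: "\<not> zp_p dvd u" and kl: "k < l"
  shows False
proof -
  define n where "n = nat (l - k)"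
  have l: "l = k + int n" and n: "n > 0" using kl by (auto simp: n_def)
  have "qp_p powi k * zp_embed u = qp_p powi k * (qp_p ^ n * zp_embed v)"
    using eq qp_p_neq_0[where 'p='p] unfolding l by (simp add: power_int_add mult.assoc)
  then have "zp_embed u = zp_embed (zp_p ^ n * v)" using qp_p_neq_0[where 'p='p] by simp
  then have "u = zp_p ^ n * v" by (simp only: zp_embed_eq_iff)
  then show False using u n by (simp add: dvd_power)
qed

lemma padic_repr_unique:
  fixes u v :: "'p::prime_card padic_int"
  assumes eq: "qp_p powi k * zp_embed u = qp_p powi l * zp_embed v" and "\<not> zp_p dvd u" "\<not> zp_p dvd v"
  shows "k = l"
  using padic_repr_less_False[OF eq] padic_repr_less_False[OF eq[symmetric]] assms
  by (cases k l rule: linorder_cases) auto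

context
  fixes u :: "'p::prime_card padic_int" and k :: int
  assumes u: "\<not> zp_p dvd u"
begin

text \<open>Uniqueness of the representation resolves the description operator in
  \<open>padic_val\<close>; absolute value and unit part then become computable.\<close>

lemma padic_val_repr [simp]: "padic_val (qp_p powi k * zp_embed u) = k"
  unfolding padic_val_def
proof (rule the_equality)
  show "\<exists>v. zp_is_unit v \<and> qp_p powi k * zp_embed u = qp_p powi k * zp_embed v"
    using u zp_is_unit_iff by blast
  fix l assume "\<exists>v. zp_is_unit v \<and> qp_p powi k * zp_embed u = qp_p powi l * zp_embed v"
  then show "l = k" using u padic_repr_unique zp_is_unit_iff by metis
qed

lemma padic_repr_neq_0: "qp_p powi k * zp_embed u \<noteq> 0"
  using u qp_p_neq_0[where 'p='p] by auto

lemma padic_abs_repr: "padic_abs (qp_p powi k * zp_embed u) = real CARD('p) powi (- k)"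
  using padic_repr_neq_0 by (simp add: padic_abs_def)

lemma unit_part_repr: "unit_part (qp_p powi k * zp_embed u) = zp_embed u"
  using qp_p_neq_0[where 'p='p] by (simp add: unit_part_def power_int_minus)

end

lemma digit0_zp_embed: "digit0 (zp_embed z) = rep_zp z 1"
proof -
  have "(THE y. zp_embed z = zp_embed y) = z" by (rule the_equality) auto
  then show ?thesis by (simp add: digit0_def)
qed

text \<open>Hensel's lemma for X^2 - z: at a square root c of the residue the derivative 2 c is
  nonzero modulo p.\<close>

lemma zp_square_iff_residue_square:
  fixes z :: "'p::prime_card padic_int"
  assumes card: "CARD('p) > 3" and z: "\<not> zp_p dvd z"
  shows "(\<exists>s. s\<^sup>2 = z) \<longleftrightarrow> (\<exists>c. c\<^sup>2 = zp_residue z)"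
proof
  assume "\<exists>s. s\<^sup>2 = z"
  then obtain s where "s\<^sup>2 = z" by blast
  then have "(zp_residue s)\<^sup>2 = zp_residue z" using zp_residue_power by metis
  then show "\<exists>c. c\<^sup>2 = zp_residue z" ..
next
  assume "\<exists>c. c\<^sup>2 = zp_residue z"
  then obtain c where c: "c\<^sup>2 = zp_residue z" by blast
  obtain k where k: "c = of_int k" by (rule mod_ring_of_int_cases)
  have c0: "c \<noteq> 0" using c z zp_residue_eq_0_iff[of z] by auto
  let ?F = "[:- z, 0, 1:]"
  have "zp_residue (poly ?F (of_int k)) = 0" using c by (simp add: k power2_eq_square)
  then have 1: "zp_p dvd poly ?F (of_int k)" by (simp only: zp_residue_eq_0_iff)
  have "poly (pderiv ?F) (of_int k) = 2 * of_int k" by (simp add: pderiv_pCons)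
  then have "zp_residue (poly (pderiv ?F) (of_int k)) \<noteq> 0"
    using c0 numeral_mod_ring_neq_0(1)[OF card] by (simp add: k)
  then have 2: "\<not> zp_p dvd poly (pderiv ?F) (of_int k)" using zp_residue_eq_0_iff by blast
  obtain r where "poly ?F r = 0" using hensel[OF 1 2] by blast
  then have "r\<^sup>2 = z" by (simp add: power2_eq_square)
  then show "\<exists>s. s\<^sup>2 = z" ..
qed

lemma power_int_double: "(x::'a::field) \<noteq> 0 \<Longrightarrow> x powi (2 * m) = (x powi m)\<^sup>2"
  by (simp only: mult_2 power2_eq_square power_int_add simp_thms)

text \<open>Squaring doubles the valuation and squares the unit, and the representation is
  unique.\<close>

lemma padic_square_iff:
  fixes u :: "'p::prime_card padic_int"
  assumes u: "\<not> zp_p dvd u"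
  shows "(\<exists>d. d\<^sup>2 = qp_p powi k * zp_embed u) \<longleftrightarrow> even k \<and> (\<exists>s. s\<^sup>2 = u)"
proof
  assume "\<exists>d. d\<^sup>2 = qp_p powi k * zp_embed u"
  then obtain d where d: "d\<^sup>2 = qp_p powi k * zp_embed u" by blast
  have "d \<noteq> 0" using d padic_repr_neq_0[OF u] by auto
  then obtain m s where s: "d = qp_p powi m * zp_embed s" "\<not> zp_p dvd s" using padic_decompose by blast
  have d2: "d\<^sup>2 = qp_p powi (2 * m) * zp_embed (s\<^sup>2)"
    unfolding s(1) power_int_double[OF qp_p_neq_0] by (simp add: power_mult_distrib)
  have s2: "\<not> zp_p dvd s\<^sup>2" using s(2) by (simp add: zp_p_dvd_power_iff)
  have k: "k = 2 * m" using padic_repr_unique[OF _ u s2] d d2 by metis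
  then have "zp_embed u = zp_embed (s\<^sup>2)" using d d2 qp_p_neq_0[where 'p='p] by simp
  then have "s\<^sup>2 = u" by (simp only: zp_embed_eq_iff)
  then show "even k \<and> (\<exists>s. s\<^sup>2 = u)" using k by auto
next
  assume "even k \<and> (\<exists>s. s\<^sup>2 = u)"
  then obtain m s where m: "k = 2 * m" "s\<^sup>2 = u" by (auto elim: evenE)
  have "(qp_p powi m * zp_embed s)\<^sup>2 = qp_p powi k * zp_embed u"
    unfolding m(1) m(2)[symmetric] power_int_double[OF qp_p_neq_0] by (simp add: power_mult_distrib)
  then show "\<exists>d. d\<^sup>2 = qp_p powi k * zp_embed u" ..
qed

lemma mod_ring_euler_criterion:
  assumes card: "CARD('p::prime_card) > 3" and c: "(of_int c :: 'p mod_ring) \<noteq> 0"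
  shows "[c ^ ((CARD('p) - 1) div 2) = 1] (mod int CARD('p)) \<longleftrightarrow> (\<exists>d. d\<^sup>2 = (of_int c :: 'p mod_ring))"
proof -
  let ?P = "int CARD('p)"
  have pr: "prime CARD('p)" by (rule prime_card)
  have E: "[Legendre c ?P = c ^ ((CARD('p) - 1) div 2)] (mod ?P)"
    using euler_criterion[OF pr, of c] card by simp
  have c0: "\<not> [c = 0] (mod ?P)" using c of_int_mod_ring_eq_iff[of c 0, where 'p='p] by simp
  have "QuadRes ?P c \<longleftrightarrow> (\<exists>d. d\<^sup>2 = (of_int c :: 'p mod_ring))"
  proof
    assume "QuadRes ?P c"
    then obtain y where "[y\<^sup>2 = c] (mod ?P)" by (auto simp: QuadRes_def)
    then have "(of_int y)\<^sup>2 = (of_int c :: 'p mod_ring)" by (simp flip: of_int_power add: of_int_mod_ring_eq_iff)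
    then show "\<exists>d. d\<^sup>2 = (of_int c :: 'p mod_ring)" ..
  next
    assume "\<exists>d. d\<^sup>2 = (of_int c :: 'p mod_ring)"
    then obtain d where d: "d\<^sup>2 = (of_int c :: 'p mod_ring)" by blast
    obtain y where y: "d = of_int y" by (rule mod_ring_of_int_cases)
    have "(of_int (y\<^sup>2) :: 'p mod_ring) = of_int c" using d y by simp
    then have "[y\<^sup>2 = c] (mod ?P)" by (simp only: of_int_mod_ring_eq_iff)
    then show "QuadRes ?P c" by (auto simp: QuadRes_def)
  qed
  moreover have "[c ^ ((CARD('p) - 1) div 2) = 1] (mod ?P) \<longleftrightarrow> QuadRes ?P c"
  proof -
    \<comment> \<open>A non-residue has Legendre symbol -1, which must stay distinct from 1 modulo
      p.\<close>
    have "\<not> [- 1 = 1] (mod ?P)"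
      using card by (simp add: cong_iff_dvd_diff zdvd_not_zless)
    then show ?thesis using E c0 unfolding Legendre_def
      by (auto dest: cong_sym cong_trans split: if_splits)
  qed
  ultimately show ?thesis by simp
qed

text \<open>The digit congruence is Euler's criterion for the residue of the unit part, hence by
  Hensel decides whether that unit is a square; the parity condition accounts for the power of p.
  For 0 both sides hold.\<close>

lemma sqrt_exists_iff_square:
  fixes D :: "'p::prime_card padic"
  assumes card: "CARD('p) > 3"
  shows "sqrt_exists D \<longleftrightarrow> (\<exists>d. d\<^sup>2 = D)"
proof (cases "D = 0")
  case True
  have "(0::'p padic)\<^sup>2 = D" using True by simp
  then show ?thesis using True unfolding sqrt_exists_def by blast
next
  case False
  then obtain k u where D: "D = qp_p powi k * zp_embed u" and u: "\<not> zp_p dvd u" by (rule padic_decompose)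
  have res: "zp_residue u \<noteq> 0" using u by (simp add: zp_residue_eq_0_iff)
  have "sqrt_exists D \<longleftrightarrow> [rep_zp u 1 ^ ((CARD('p) - 1) div 2) = 1] (mod int CARD('p)) \<and> even k"
    using False u by (simp add: sqrt_exists_def D unit_part_repr digit0_zp_embed qp_p_neq_0)
  also have "\<dots> \<longleftrightarrow> (\<exists>c. c\<^sup>2 = zp_residue u) \<and> even k"
    using mod_ring_euler_criterion[OF card, of "rep_zp u 1"] res by (simp add: zp_residue_def)
  also have "\<dots> \<longleftrightarrow> even k \<and> (\<exists>s. s\<^sup>2 = u)"
    using zp_square_iff_residue_square[OF card u] by blast
  also have "\<dots> \<longleftrightarrow> (\<exists>d. d\<^sup>2 = D)" unfolding D padic_square_iff[OF u] ..
  finally show ?thesis .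
qed

text \<open>Since f'(r) is nonzero, the discriminant of f is a square exactly when that of the
  quadratic cofactor is, that is, when the cofactor splits. Discriminant 0 counts as a square: the
  cofactor then has a double root, and the count with multiplicity is still 3.\<close>

lemma size_proots_cubic:
  fixes a b r :: "'a::field"
  assumes two: "(2::'a) \<noteq> 0" and r: "r ^ 3 + a * r = b" and simple: "3 * r\<^sup>2 + a \<noteq> 0"
  shows "size (proots [:- b, a, 0, 1:]) = (if \<exists>d. d\<^sup>2 = - 4 * a ^ 3 - 27 * b\<^sup>2 then 3 else 1)"
proof -
  let ?g = "[:a + r\<^sup>2, r, 1:]"
  have "[:- b, a, 0, 1:] = [:- r, 1:] * ?g"
    unfolding r[symmetric] by (simp add: algebra_simps power2_eq_square power3_eq_cube)
  then have "proots [:- b, a, 0, 1:] = proots [:- r, 1:] + proots ?g"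
    using proots_mult[of "[:- r, 1:]" ?g] by (simp only: pCons_eq_0_iff one_neq_zero simp_thms)
  moreover have lin: "size (proots [:- c, 1:]) = 1" for c :: 'a
    using proots_linear_factor[of "- c"] by (simp only: size_single)
  ultimately have sz: "size (proots [:- b, a, 0, 1:]) = 1 + size (proots ?g)"
    by (simp only: size_union)
  have D: "- 4 * a ^ 3 - 27 * b\<^sup>2 = (3 * r\<^sup>2 + a)\<^sup>2 * (- 3 * r\<^sup>2 - 4 * a)"
    unfolding r[symmetric] by Groebner_Basis.algebra
  show ?thesis
  proof (cases "\<exists>d. d\<^sup>2 = - 4 * a ^ 3 - 27 * b\<^sup>2")
    case True
    then obtain d where d: "d\<^sup>2 = - 4 * a ^ 3 - 27 * b\<^sup>2" by blast
    define e where "e = d / (3 * r\<^sup>2 + a)"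
    have e: "e\<^sup>2 = - 3 * r\<^sup>2 - 4 * a" using d simple unfolding D by (simp add: e_def power_divide)
    define x where "x = (- r + e) / 2"
    define y where "y = (- r - e) / 2"
    have xy: "2 * x = - r + e" "2 * y = - r - e" using two by (auto simp: x_def y_def)
    have "2 * (x + y + r) = (2 * x) + (2 * y) + 2 * r" by (simp add: algebra_simps)
    also have "\<dots> = 0" unfolding xy by simp
    finally have "x + y + r = 0" using two by (simp only: mult_eq_0_iff) simp
    then have s: "r = - y - x" by Groebner_Basis.algebra
    have "2 * (2 * (x * y - (a + r\<^sup>2))) = (2 * x) * (2 * y) - 4 * (a + r\<^sup>2)" by (simp add: algebra_simps)
    also have "\<dots> = r\<^sup>2 - e\<^sup>2 - 4 * (a + r\<^sup>2)" unfolding xy by (simp add: algebra_simps power2_eq_square)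
    also have "\<dots> = 0" unfolding e by (simp add: algebra_simps)
    finally have "x * y - (a + r\<^sup>2) = 0" using two by (simp only: mult_eq_0_iff) simp
    then have p: "a + r\<^sup>2 = x * y" by simp
    have "?g = [:- x, 1:] * [:- y, 1:]" unfolding p unfolding s by simp
    then have "proots ?g = proots [:- x, 1:] + proots [:- y, 1:]"
      using proots_mult[of "[:- x, 1:]" "[:- y, 1:]"] by (simp only: pCons_eq_0_iff one_neq_zero simp_thms)
    then have "size (proots ?g) = 2" by (simp only: size_union lin)
    then show ?thesis using True sz by simp
  next
    case False
    have "poly ?g x \<noteq> 0" for x
    proof
      assume "poly ?g x = 0"
      then have "x\<^sup>2 + r * x + a + r\<^sup>2 = 0" by (simp add: algebra_simps power2_eq_square)
      then have "((3 * r\<^sup>2 + a) * (2 * x + r))\<^sup>2 = (3 * r\<^sup>2 + a)\<^sup>2 * (- 3 * r\<^sup>2 - 4 * a)"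
        by Groebner_Basis.algebra
      then show False using False D by metis
    qed
    then have "set_mset (proots ?g) = {}" using set_count_proots[of ?g] by auto
    then have "proots ?g = {#}" by (simp only: set_mset_eq_empty_iff)
    then show ?thesis using False unfolding sz by simp
  qed
qed

section \<open>Roots of the cubic\<close>

lemma power_int_gt1_iff:
  fixes q :: real
  assumes "q > 1"
  shows "q powi m > 1 \<longleftrightarrow> m > 0" "q powi m < 1 \<longleftrightarrow> m < 0" "q powi m = 1 \<longleftrightarrow> m = 0"
proof -
  have pos: "q powi m > 1" if "m > 0" for m
  proof -
    have "q powi m = q ^ nat m" using that by (simp add: power_int_def)
    then show ?thesis using that assms by (simp add: one_less_power)
  qed
  have neg: "q powi m < 1" if "m < 0" for m
  proof -
    have "inverse (q powi (- m)) < 1" using pos[of "- m"] that by (intro inverse_less_1_iff[THEN iffD2]) simp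
    then show ?thesis by (simp add: power_int_minus)
  qed
  show "q powi m > 1 \<longleftrightarrow> m > 0" "q powi m < 1 \<longleftrightarrow> m < 0" "q powi m = 1 \<longleftrightarrow> m = 0"
    using pos[of m] neg[of m] by (cases m "0::int" rule: linorder_cases; simp)+
qed

text \<open>Compare the valuation j of \<open>x\<close> with \<open>k\<close>. If j > k, cancelling
  p^(3k) makes p divide the unit \<open>\<beta>\<close>. If j < k, the cube dominates: cancelling
  p^(3j) makes p divide w^3 for the unit w of \<open>x\<close>.\<close>

lemma padic_root_repr:
  fixes \<alpha> \<beta> :: "'p::prime_card padic_int"
  assumes \<beta>: "\<not> zp_p dvd \<beta>"
    and x: "x ^ 3 + (qp_p powi (2 * k) * zp_embed \<alpha>) * x = qp_p powi (3 * k) * zp_embed \<beta>"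
  obtains w where "\<not> zp_p dvd w" "x = qp_p powi k * zp_embed w"
proof -
  note p0 = qp_p_neq_0[where 'p='p]
  have "x \<noteq> 0" using x padic_repr_neq_0[OF \<beta>, of "3 * k"] by auto
  then obtain j w where w: "x = qp_p powi j * zp_embed w" "\<not> zp_p dvd w" using padic_decompose by blast
  define K where "K = (qp_p powi k :: 'p padic)"
  define J where "J = (qp_p powi j :: 'p padic)"
  have K: "qp_p powi (2 * k) = K\<^sup>2" "qp_p powi (3 * k) = K ^ 3"
    unfolding K_def using power_int_power'[of "qp_p :: 'p padic" k 2] power_int_power'[of "qp_p :: 'p padic" k 3]
    by (simp_all add: mult.commute)
  have K0: "K \<noteq> 0" and J0: "J \<noteq> 0" using p0 by (simp_all add: K_def J_def)
  have eq: "(J * zp_embed w) ^ 3 + K\<^sup>2 * zp_embed \<alpha> * (J * zp_embed w) = K ^ 3 * zp_embed \<beta>"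
    using x unfolding w(1) K J_def by simp
  consider n where "j = k + int n" "n > 0" | n where "k = j + int n" "n > 0" | "j = k"
    by (metis linorder_cases zless_iff_Suc_zadd zero_less_Suc)
  then show ?thesis
  proof cases
    case 1
    then have J: "J = K * qp_p ^ n" unfolding J_def K_def using p0 by (simp add: power_int_add)
    have "K ^ 3 * ((qp_p ^ n * zp_embed w) ^ 3 + zp_embed \<alpha> * (qp_p ^ n * zp_embed w)) = K ^ 3 * zp_embed \<beta>"
      using eq unfolding J by (simp add: algebra_simps power2_eq_square power3_eq_cube)
    then have "zp_embed ((zp_p ^ n * w) ^ 3 + \<alpha> * (zp_p ^ n * w)) = zp_embed \<beta>" using K0 by simp
    then have "\<beta> = zp_p ^ n * w * ((zp_p ^ n * w)\<^sup>2 + \<alpha>)"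
      by (simp only: zp_embed_eq_iff) (simp add: algebra_simps power2_eq_square power3_eq_cube)
    moreover have "zp_p dvd zp_p ^ n * w * ((zp_p ^ n * w)\<^sup>2 + \<alpha>)" using 1 by (simp add: dvd_power mult.assoc)
    ultimately show ?thesis using \<beta> by blast
  next
    case 2
    then have K': "K = J * qp_p ^ n" unfolding J_def K_def using p0 by (simp add: power_int_add)
    have "J ^ 3 * (zp_embed w ^ 3 + qp_p ^ n * (qp_p ^ n * zp_embed \<alpha> * zp_embed w)) = J ^ 3 * (qp_p ^ n * ((qp_p ^ n)\<^sup>2 * zp_embed \<beta>))"
      using eq unfolding K' by (simp add: algebra_simps power2_eq_square power3_eq_cube)
    then have "zp_embed (w ^ 3 + zp_p ^ n * (zp_p ^ n * \<alpha> * w)) = zp_embed (zp_p ^ n * ((zp_p ^ n)\<^sup>2 * \<beta>))" using J0 by simp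
    then have "w ^ 3 = zp_p ^ n * ((zp_p ^ n)\<^sup>2 * \<beta> - zp_p ^ n * \<alpha> * w)"
      by (simp only: zp_embed_eq_iff) (simp add: algebra_simps)
    moreover have "zp_p dvd zp_p ^ n * ((zp_p ^ n)\<^sup>2 * \<beta> - zp_p ^ n * \<alpha> * w)" using 2 by (simp add: dvd_power)
    ultimately have "zp_p dvd w ^ 3" by simp
    then show ?thesis using w(2) by (simp add: zp_p_dvd_power_iff)
  next
    case 3
    then show ?thesis using w that by blast
  qed
qed

text \<open>The three roots sum to 0, so a double root r is accompanied by -2 r, where the
  derivative is 9 r^2; and r is nonzero because \<open>B\<close> is.\<close>

lemma simple_root_mod_p:
  fixes A B r :: "'a::field"
  assumes three: "(3::'a) \<noteq> 0" and B: "B \<noteq> 0" and r: "r ^ 3 + A * r = B"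
  obtains s where "s ^ 3 + A * s = B" "3 * s\<^sup>2 + A \<noteq> 0"
proof (cases "3 * r\<^sup>2 + A = 0")
  case True
  then have A: "A = - (3 * r\<^sup>2)" by (simp add: eq_neg_iff_add_eq_0 add.commute)
  have "r \<noteq> 0" using r B by auto
  have "(- 2 * r) ^ 3 + A * (- 2 * r) = B"
    using r unfolding A by (simp add: algebra_simps power2_eq_square power3_eq_cube)
  moreover have "3 * (- 2 * r)\<^sup>2 + A = 3 * (3 * r\<^sup>2)" unfolding A by (simp add: power_mult_distrib)
  then have "3 * (- 2 * r)\<^sup>2 + A \<noteq> 0" using three \<open>r \<noteq> 0\<close> by (simp only: mult_eq_0_iff power_eq_0_iff) simp
  ultimately show ?thesis by (rule that)
qed (use r that in blast)

lemma zp_simple_root: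
  fixes \<alpha> \<beta> :: "'p::prime_card padic_int"
  assumes card: "CARD('p) > 3" and \<beta>: "\<not> zp_p dvd \<beta>"
    and r: "r ^ 3 + zp_residue \<alpha> * r = zp_residue \<beta>"
  obtains \<rho> where "\<rho> ^ 3 + \<alpha> * \<rho> = \<beta>" "\<not> zp_p dvd 3 * \<rho>\<^sup>2 + \<alpha>"
proof -
  have "zp_residue \<beta> \<noteq> 0" using \<beta> zp_residue_eq_0_iff by blast
  then obtain s where s: "s ^ 3 + zp_residue \<alpha> * s = zp_residue \<beta>" "3 * s\<^sup>2 + zp_residue \<alpha> \<noteq> 0"
    using simple_root_mod_p[OF numeral_mod_ring_neq_0(2)[OF card] _ r] by blast
  obtain k where k: "s = of_int k" by (rule mod_ring_of_int_cases)
  let ?F = "[:- \<beta>, \<alpha>, 0, 1:]"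
  have F: "poly ?F x = x ^ 3 + \<alpha> * x - \<beta>" for x by (simp add: algebra_simps power3_eq_cube)
  have F': "poly (pderiv ?F) x = 3 * x\<^sup>2 + \<alpha>" for x
    by (simp add: pderiv_pCons algebra_simps power2_eq_square)
  have "zp_residue (poly ?F (of_int k)) = 0" using s(1) unfolding F by (simp add: k)
  then have 1: "zp_p dvd poly ?F (of_int k)" by (simp only: zp_residue_eq_0_iff)
  have "zp_residue (poly (pderiv ?F) (of_int k)) \<noteq> 0" using s(2) unfolding F' by (simp add: k)
  then have 2: "\<not> zp_p dvd poly (pderiv ?F) (of_int k)" using zp_residue_eq_0_iff by blast
  obtain \<rho> where \<rho>: "poly ?F \<rho> = 0" "zp_p dvd \<rho> - of_int k" using hensel[OF 1 2] by blast
  have "zp_residue (\<rho> - of_int k) = 0" using \<rho>(2) by (simp only: zp_residue_eq_0_iff)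
  then have "zp_residue \<rho> = s" by (simp add: k)
  then have "zp_residue (3 * \<rho>\<^sup>2 + \<alpha>) \<noteq> 0" using s(2) by simp
  then have "\<not> zp_p dvd 3 * \<rho>\<^sup>2 + \<alpha>" using zp_residue_eq_0_iff by blast
  moreover have "\<rho> ^ 3 + \<alpha> * \<rho> = \<beta>" using \<rho>(1) unfolding F by simp
  ultimately show ?thesis using that by blast
qed


text \<open>With a root r given and D nonzero, a square D is the pattern of three distinct roots and
  a nonsquare D that of one root; these have u = 0 and u nonzero respectively.\<close>

lemma residue_disc_square_iff:
  fixes \<alpha> \<beta> :: "'p::prime_card padic_int"
  defines "D \<equiv> - 4 * zp_residue \<alpha> ^ 3 - 27 * zp_residue \<beta> ^ 2"
    and "u \<equiv> of_int (useq (rep_zp \<alpha> 1) (rep_zp \<beta> 1) (CARD('p) - 2)) :: 'p mod_ring"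
  assumes card: "CARD('p) > 3" and \<alpha>: "zp_residue \<alpha> \<noteq> 0" and \<beta>: "zp_residue \<beta> \<noteq> 0"
    and r: "r ^ 3 + zp_residue \<alpha> * r = zp_residue \<beta>" and D: "D \<noteq> 0"
  shows "D * u\<^sup>2 = 0 \<longleftrightarrow> (\<exists>c. c\<^sup>2 = D)"
proof
  note eqs = zp_residue_def[of \<alpha>] zp_residue_def[of \<beta>]
  assume "D * u\<^sup>2 = 0"
  then have "u = 0" using D by simp
  then show "\<exists>c. c\<^sup>2 = D"
    using one_root_imp_u_neq_0[OF card \<alpha>[unfolded eqs] \<beta>[unfolded eqs] r[unfolded eqs]]
    unfolding u_def D_def eqs by metis
next
  note eqs = zp_residue_def[of \<alpha>] zp_residue_def[of \<beta>]
  assume "\<exists>c. c\<^sup>2 = D"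
  then obtain c where c: "D = c\<^sup>2" by metis
  then have "c \<noteq> 0" using D by auto
  then have "u = 0"
    unfolding u_def
    by (rule three_roots_imp_u_eq_0[OF card \<alpha>[unfolded eqs] \<beta>[unfolded eqs] r[unfolded eqs] c[unfolded D_def eqs]])
  then show "D * u\<^sup>2 = 0" by simp
qed

theorem mainTheorem2:
  fixes a b :: "'p::prime_card padic"
  assumes "CARD('p) > 3"
    and "a * b \<noteq> 0"
    and "(a, b) \<in> Delta2"
  shows "(solvable_in a b padic_Zp_units 3 \<longleftrightarrow> padic_abs b = 1 \<and> cond_star a b) \<and>
    (solvable_in a b (padic_Zp - padic_Zp_units) 3 \<longleftrightarrow> padic_abs b < 1 \<and> cond_star a b) \<and>
    (solvable_in a b (UNIV - padic_Zp) 3 \<longleftrightarrow> padic_abs b > 1 \<and> cond_star a b) \<and>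
    (solvable_in a b padic_Zp_units 1 \<longleftrightarrow> padic_abs b = 1 \<and> cond_2star a b) \<and>
    (solvable_in a b (padic_Zp - padic_Zp_units) 1 \<longleftrightarrow> padic_abs b < 1 \<and> cond_2star a b) \<and>
    (solvable_in a b (UNIV - padic_Zp) 1 \<longleftrightarrow> padic_abs b > 1 \<and> cond_2star a b)"
proof -
  note card = assms(1)
  let ?q = "real CARD('p)"
  have q: "?q > 1" using card by simp
  have "a \<noteq> 0" "b \<noteq> 0" using assms(2) by auto
  obtain i \<alpha> where a: "a = qp_p powi i * zp_embed \<alpha>" and \<alpha>: "\<not> zp_p dvd \<alpha>"
    using padic_decompose[OF \<open>a \<noteq> 0\<close>] by blast
  obtain j \<beta> where b: "b = qp_p powi j * zp_embed \<beta>" and \<beta>: "\<not> zp_p dvd \<beta>"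
    using padic_decompose[OF \<open>b \<noteq> 0\<close>] by blast
  have abs_b: "padic_abs b = ?q powi (- j)" unfolding b by (rule padic_abs_repr[OF \<beta>])
  have abs_a: "padic_abs a = ?q powi (- i)" unfolding a by (rule padic_abs_repr[OF \<alpha>])
  have "padic_abs a ^ 3 = padic_abs b ^ 2" using assms(3) by (simp add: Delta2_def)
  then have "?q powi (- i * 3) = ?q powi (- j * 2)"
    unfolding abs_a abs_b by (simp add: power_int_power')
  then have "?q powi (2 * j - 3 * i) = 1"
    using q power_int_add[of ?q "- i * 3" "2 * j"] power_int_add[of ?q "- j * 2" "2 * j"] by (simp add: mult.commute)
  then have ij: "2 * j = 3 * i" using power_int_gt1_iff(3)[OF q] by simp
  \<comment> \<open>2 j = 3 i means that i = 2 k and j = 3 k for this k; p^k is the scale of the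
    substitution.\<close>
  define k where "k = j - i"
  have i: "i = 2 * k" and j: "j = 3 * k" using ij by (auto simp: k_def)

  define \<delta> where "\<delta> = - 4 * \<alpha> ^ 3 - 27 * \<beta>\<^sup>2"
  have unit: "unit_part a = zp_embed \<alpha>" "unit_part b = zp_embed \<beta>"
    unfolding a b using \<alpha> \<beta> by (simp_all only: unit_part_repr not_False_eq_True)
  have Dstar: "Dstar a b = zp_embed \<delta>" by (simp add: Dstar_def unit \<delta>_def)
  have coef: "coef0 a = rep_zp \<alpha> 1" "coef0 b = rep_zp \<beta> 1"
    by (simp_all add: coef0_def unit digit0_zp_embed)
  have res_\<delta>: "zp_residue \<delta> = - 4 * zp_residue \<alpha> ^ 3 - 27 * (zp_residue \<beta>)\<^sup>2" by (simp add: \<delta>_def)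
  define u where "u = (of_int (useq (rep_zp \<alpha> 1) (rep_zp \<beta> 1) (CARD('p) - 2)) :: 'p mod_ring)"
  have Du: "(of_int (Du a b) :: 'p mod_ring) = zp_residue \<delta> * u\<^sup>2"
    unfolding res_\<delta> by (simp add: Du_def D0_def coef u_def zp_residue_def)
  have "\<not> [Du a b = 9 * coef0 a ^ 2] (mod int CARD('p))"
    using assms(3) by (simp add: Delta2_def)
  then have "(of_int (Du a b) :: 'p mod_ring) \<noteq> of_int (9 * coef0 a ^ 2)"
    by (simp only: of_int_mod_ring_eq_iff not_False_eq_True)
  then have nd: "zp_residue \<delta> * u\<^sup>2 \<noteq> 9 * (zp_residue \<alpha>)\<^sup>2"
    unfolding Du by (simp add: coef zp_residue_def)
  have res: "zp_residue \<alpha> \<noteq> 0" "zp_residue \<beta> \<noteq> 0" using \<alpha> \<beta> zp_residue_eq_0_iff by blast+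
  \<comment> \<open>Without a root modulo p, the congruence ruled out by \<open>Delta2\<close> would
    hold.\<close>
  have "\<exists>r. r ^ 3 + zp_residue \<alpha> * r = zp_residue \<beta>"
    using no_root_imp_Du_eq[OF card res[unfolded zp_residue_def]] nd
    unfolding res_\<delta> u_def zp_residue_def[of \<alpha>] zp_residue_def[of \<beta>] by blast
  then obtain r where r: "r ^ 3 + zp_residue \<alpha> * r = zp_residue \<beta>" by blast

  obtain \<rho> where \<rho>: "\<rho> ^ 3 + \<alpha> * \<rho> = \<beta>" "\<not> zp_p dvd 3 * \<rho>\<^sup>2 + \<alpha>"
    using zp_simple_root[OF card \<beta> r] .
  define K where "K = (qp_p powi k :: 'p padic)"
  have K0: "K \<noteq> 0" using qp_p_neq_0[where 'p='p] by (simp add: K_def)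
  have K: "qp_p powi i = K\<^sup>2" "qp_p powi j = K ^ 3"
    unfolding K_def i j power_int_power' by (simp_all add: mult.commute)
  define x where "x = K * zp_embed \<rho>"
  have x_root: "x ^ 3 + a * x = b"
  proof -
    have "x ^ 3 + a * x = K ^ 3 * zp_embed (\<rho> ^ 3 + \<alpha> * \<rho>)"
      unfolding x_def a K by (simp add: algebra_simps power2_eq_square power3_eq_cube)
    then show ?thesis unfolding \<rho>(1) b K .
  qed
  have "3 * x\<^sup>2 + a = K\<^sup>2 * zp_embed (3 * \<rho>\<^sup>2 + \<alpha>)"
    unfolding x_def a K by (simp add: algebra_simps power2_eq_square)
  moreover have "3 * \<rho>\<^sup>2 + \<alpha> \<noteq> 0" using \<rho>(2) by auto
  ultimately have x_simple: "3 * x\<^sup>2 + a \<noteq> 0" using K0 by (simp only: mult_eq_0_iff zp_embed_eq_0_iff power_eq_0_iff) simp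

  have two: "(2 :: 'p padic) \<noteq> 0"
  proof
    assume "(2 :: 'p padic) = 0"
    then have "zp_embed (2 :: 'p padic_int) = 0" by simp
    then have "(2 :: 'p padic_int) = 0" by (simp only: zp_embed_eq_0_iff)
    then have "zp_residue (2 :: 'p padic_int) = 0" by (simp add: zp_residue_eq_0_iff)
    then show False using numeral_mod_ring_neq_0(1)[OF card] by simp
  qed
  define sq where "sq \<longleftrightarrow> (\<exists>d. d\<^sup>2 = Dstar a b)"
  have disc: "- 4 * a ^ 3 - 27 * b\<^sup>2 = (K ^ 3)\<^sup>2 * Dstar a b"
    unfolding Dstar unfolding \<delta>_def a b K by (simp add: algebra_simps power2_eq_square power3_eq_cube)
  have "(\<exists>d. d\<^sup>2 = - 4 * a ^ 3 - 27 * b\<^sup>2) \<longleftrightarrow> sq"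
  proof
    assume "\<exists>d. d\<^sup>2 = - 4 * a ^ 3 - 27 * b\<^sup>2"
    then obtain d where "d\<^sup>2 = (K ^ 3)\<^sup>2 * Dstar a b" unfolding disc by blast
    then have "(d / K ^ 3)\<^sup>2 = Dstar a b" using K0 by (simp add: power_divide)
    then show sq unfolding sq_def by blast
  next
    assume sq
    then obtain d where "d\<^sup>2 = Dstar a b" unfolding sq_def by blast
    then have "(K ^ 3 * d)\<^sup>2 = (K ^ 3)\<^sup>2 * Dstar a b" by (simp add: power_mult_distrib)
    then show "\<exists>d. d\<^sup>2 = - 4 * a ^ 3 - 27 * b\<^sup>2" unfolding disc by blast
  qed
  then have size: "size (proots [:- b, a, 0, 1:]) = (if sq then 3 else 1)"
    using size_proots_cubic[OF two x_root x_simple] by (simp only:)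

  have sqrt: "sqrt_exists (Dstar a b) \<longleftrightarrow> sq"
    unfolding sq_def by (rule sqrt_exists_iff_square[OF card])
  have cond: "cond_star a b \<longleftrightarrow> sq" "cond_2star a b \<longleftrightarrow> \<not> sq"
  proof -
    \<comment> \<open>These are the cases |D| = 0, |D| = 1 and 0 < |D| < 1. In the middle one the
      conditions are phrased through \<open>Du\<close>, in the outer ones through
      \<open>sqrt_exists\<close>.\<close>
    consider "\<delta> = 0" | "\<not> zp_p dvd \<delta>" | m w where "\<delta> = zp_p ^ Suc m * w" "\<not> zp_p dvd w"
      by (metis zp_decompose mult_1 power_0 not0_implies_Suc)
    then have "(cond_star a b \<longleftrightarrow> sq) \<and> (cond_2star a b \<longleftrightarrow> \<not> sq)"
    proof cases
      case 1
      then have D0: "Dstar a b = 0" "padic_abs (Dstar a b) = 0" by (simp_all add: Dstar padic_abs_def)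
      then have sq using sqrt by (simp add: sqrt_exists_def)
      then show ?thesis using D0 sqrt by (simp add: cond_star_def cond_2star_def)
    next
      case 2
      have abs: "padic_abs (Dstar a b) = 1"
        using padic_abs_repr[OF 2, of 0] by (simp add: Dstar)
      have "[Du a b = 0] (mod int CARD('p)) \<longleftrightarrow> zp_residue \<delta> * u\<^sup>2 = 0"
        using of_int_mod_ring_eq_iff[of "Du a b" 0, where 'p='p] Du by simp
      also have "\<dots> \<longleftrightarrow> (\<exists>c. c\<^sup>2 = zp_residue \<delta>)"
        using residue_disc_square_iff[OF card res r] zp_residue_eq_0_iff[of \<delta>] 2
        unfolding res_\<delta> u_def by blast
      also have "\<dots> \<longleftrightarrow> (\<exists>s. s\<^sup>2 = \<delta>)" using zp_square_iff_residue_square[OF card 2] ..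
      also have "\<dots> \<longleftrightarrow> sq" using padic_square_iff[OF 2, of 0] by (simp add: sq_def Dstar)
      finally show ?thesis
        using abs \<open>\<not> [Du a b = 9 * coef0 a ^ 2] (mod int CARD('p))\<close>
        by (simp add: cond_star_def cond_2star_def)
    next
      case 3
      have "Dstar a b = qp_p powi (int (Suc m)) * zp_embed w"
        unfolding Dstar 3(1) power_int_of_nat by simp
      then have abs: "padic_abs (Dstar a b) = ?q powi (- int (Suc m))"
        using padic_abs_repr[OF 3(2)] by (simp only:)
      have "?q powi (- int (Suc m)) < 1" using power_int_gt1_iff(2)[OF q] by simp
      moreover have "?q powi (- int (Suc m)) > 0" using q by simp
      ultimately show ?thesis using sqrt abs by (simp add: cond_star_def cond_2star_def)
    qed
    then show "cond_star a b \<longleftrightarrow> sq" "cond_2star a b \<longleftrightarrow> \<not> sq" by blast+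
  qed

  have roots: "set_mset (proots [:- b, a, 0, 1:]) = {y. y ^ 3 + a * y = b}"
  proof -
    have "poly [:- b, a, 0, 1:] y = 0 \<longleftrightarrow> y ^ 3 + a * y = b" for y
    proof -
      have "poly [:- b, a, 0, 1:] y = y ^ 3 + a * y - b" by (simp add: algebra_simps power3_eq_cube)
      then show ?thesis by (simp only: right_minus_eq)
    qed
    moreover have "set_mset (proots [:- b, a, 0, 1:]) = {y. poly [:- b, a, 0, 1:] y = 0}"
      by (rule set_count_proots) simp
    ultimately show ?thesis by (simp only:)
  qed
  have abs_root: "padic_abs y = ?q powi (- k)" if "y ^ 3 + a * y = b" for y
  proof -
    have "y ^ 3 + (qp_p powi (2 * k) * zp_embed \<alpha>) * y = qp_p powi (3 * k) * zp_embed \<beta>"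
      using that unfolding a b i j .
    then obtain w where "\<not> zp_p dvd w" "y = qp_p powi k * zp_embed w"
      by (rule padic_root_repr[OF \<beta>])
    then show ?thesis by (simp only: padic_abs_repr not_False_eq_True)
  qed
  \<comment> \<open>All roots share one absolute value, so a region described by \<open>P\<close>
    contains all of them or none. The root \<open>x\<close> keeps the inclusion from being
    vacuous.\<close>
  have solv: "solvable_in a b S n \<longleftrightarrow> (if sq then 3 else 1) = n \<and> P (?q powi (- k))"
    if "\<And>y. y \<in> S \<longleftrightarrow> P (padic_abs y)" for S n P
  proof -
    have "y \<in> S \<longleftrightarrow> P (?q powi (- k))" if "y ^ 3 + a * y = b" for y
      unfolding \<open>\<And>y. y \<in> S \<longleftrightarrow> P (padic_abs y)\<close> abs_root[OF that] ..
    then have "{y. y ^ 3 + a * y = b} \<subseteq> S \<longleftrightarrow> P (?q powi (- k))" using x_root by blast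
    then show ?thesis unfolding solvable_in_def size roots by (simp only:)
  qed
  \<comment> \<open>The roots have absolute value p^(-k) and \<open>b\<close> has p^(-3k), so both
    compare with 1 in the same way.\<close>
  have "solvable_in a b padic_Zp_units n \<longleftrightarrow> (if sq then 3 else 1) = n \<and> padic_abs b = 1" for n
    using solv[of padic_Zp_units "\<lambda>t. t = 1" n]
    by (simp add: padic_Zp_units_def abs_b j power_int_gt1_iff(3)[OF q])
  moreover have "solvable_in a b (padic_Zp - padic_Zp_units) n \<longleftrightarrow> (if sq then 3 else 1) = n \<and> padic_abs b < 1" for n
  proof -
    have "y \<in> padic_Zp - padic_Zp_units \<longleftrightarrow> padic_abs y < 1" for y :: "'p padic"
      by (auto simp: padic_Zp_def padic_Zp_units_def)
    then show ?thesis
      using solv[of "padic_Zp - padic_Zp_units" "\<lambda>t. t < 1" n]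
      by (simp only: abs_b j power_int_gt1_iff(2)[OF q]) simp
  qed
  moreover have "solvable_in a b (UNIV - padic_Zp) n \<longleftrightarrow> (if sq then 3 else 1) = n \<and> padic_abs b > 1" for n
    using solv[of "UNIV - padic_Zp" "\<lambda>t. t > 1" n]
    by (simp add: padic_Zp_def abs_b j power_int_gt1_iff(1)[OF q] not_le)
  ultimately show ?thesis unfolding cond by auto
qed

end
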